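(* Let $\mu\in\Delta_m$, $\nu\in\Delta_n$ have positive entries and let $\mathcal E\subset\{1,\dots,m\}\times\{1,\dots,n\}$ be such that the bipartite graph on $\{1,\dots,m\}\sqcup\{1,\dots,n\}$ with edge set $\mathcal E$ has no isolated vertex. Suppose that $\mathcal S=\overline{\mathcal S}$, where $\mathcal S,\overline{\mathcal S}\subset\mathcal E$ are the sets associated with $\mu,\nu,\mathcal E$ (see context). There exist constants $K_0,B,R>0$ depending only on $\mu,\nu,\mathcal E$ such that the following holds. Let $C\in(\mathbb R\cup\{+\infty\})^{m\times n}$ with $\{(i,j):C_{ij}<\infty\}=\mathcal E$, let $\tau>0$, $\delta\ge0$, and let $(f^0,g^0)\in\mathbb R^m\times\mathbb R^n$ be such that $U^0_{ij}=(f^0_i+g^0_j-C_{ij})/\tau$ satisfies $$\forall(i,j)\in\mathcal E,\ -\delta\le U^0_{ij}\le\delta\qquad\text{and}\qquad\forall(i,j)\notin\mathcal E,\ U^0_{ij}=-\infty.$$ Then the rescaled one-iteration increments $v^k,w^k$ of the Sinkhorn algorithm initialized at $(f^0,g^0)$ satisfy $$\forall k\ge K_0(1+\delta),\qquad \|v^k-v^*(\mathcal E)\|_\infty,\ \|w^k-w^*(\mathcal E)\|_\infty\le B(1+\delta)\big(1-e^{-R(1+\delta)}\big)^k.$$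
   Context: $\Delta_N$ is the probability simplex in $\mathbb R^N$; $H(p|q)=\sum_I p_I\log(p_I/q_I)$ is relative entropy. **Sinkhorn algorithm with possibly infinite costs.** With the convention $\exp(-\infty)=0$ (i.e. all sums restricted to $(i,j)\in\mathcal E$), $f_\tau[g]_i=-\tau\log\sum_j e^{(-C_{ij}+g_j)/\tau}\nu_j$ and $g_\tau[f]_j=-\tau\log\sum_i e^{(-C_{ij}+f_i)/\tau}\mu_i$. From $(f^0,g^0)$: for $k\ge0$ even, $f^{k+1}=f_\tau[g^k]$, $g^{k+1}=g^k$; for $k$ odd, $f^{k+1}=f^k$, $g^{k+1}=g_\tau[f^k]$. The rescaled increments are $v^k=(f^k-f^{k-2})/\tau$, $w^k=(g^k-g^{k-2})/\tau$ for $k\ge2$, with $v^1=(f^1-f^0)/\tau$ and $w^1=0$. The logits are $U^k_{ij}=(f^k_i+g^k_j-C_{ij})/\tau$. **The vectors $v^*(\mathcal E),w^*(\mathcal E)$.** $\Delta_{\mathcal E}$ is the set of probability distributions on $\mathcal E$; for $\pi\in\Delta_{\mathcal E}$, $(X_\sharp\pi)_i=\sum_{j:(i,j)\in\mathcal E}\pi_{ij}$ and $(Y_\sharp\pi)_j=\sum_{i:(i,j)\in\mathcal E}\pi_{ij}$. $\mu^*(\mathcal E)$ is the minimizer of $H(\bar\mu|\mu)$ over $\bar\mu$ such that there is $Q\in\Delta_{\mathcal E}$ with $X_\sharp Q=\bar\mu$, $Y_\sharp Q=\nu$; $\nu^*(\mathcal E)$ is the minimizer of $H(\bar\nu|\nu)$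 over $\bar\nu$ such that there is $P\in\Delta_{\mathcal E}$ with $X_\sharp P=\mu$, $Y_\sharp P=\bar\nu$; and $v^*(\mathcal E)_i=\log(\mu_i/\mu^*_i(\mathcal E))$, $w^*(\mathcal E)_j=\log(\nu_j/\nu^*_j(\mathcal E))$. **The sets $\mathcal S,\overline{\mathcal S}$.** $\overline{\mathcal S}=\{(i,j)\in\mathcal E: v^*(\mathcal E)_i+w^*(\mathcal E)_j=0\}$. It is known that $U^{2k}$ and $U^{2k+1}$ converge in $(\mathbb R\cup\{-\infty\})^{m\times n}$ as $k\to\infty$, and that the sets of indices where the two limits are $>-\infty$ coincide and depend only on $\mu,\nu,\mathcal E$; this common set is $\mathcal S$. Equivalently, $(i_0,j_0)\in\mathcal S$ iff there exists $Q\in\Delta_{\mathcal E}$ with $X_\sharp Q=\mu^*(\mathcal E)$, $Y_\sharp Q=\nu$ and $Q_{i_0j_0}>0$. *)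

theory Defs
  imports "HOL-Analysis.Analysis"
begin

definition prob_simplex :: "(real ^ 'n) set" where
  "prob_simplex = {p. (\<forall>i. 0 \<le> p $ i) \<and> (\<Sum>i\<in>UNIV. p $ i) = 1}"

text \<open>The usual convention \<open>0 log 0 = 0\<close> is respected, because \<open>0 * x = 0\<close>.\<close>

definition rel_entropy :: "real ^ 'n \<Rightarrow> real ^ 'n \<Rightarrow> real" where
  "rel_entropy p q = (\<Sum>i\<in>UNIV. p $ i * ln (p $ i / q $ i))"

text \<open>A probability distribution on \<open>E\<close> is an \<open>m \<times> n\<close> matrix that vanishes outside \<open>E\<close>.\<close>

definition plans :: "('m \<times> 'n) set \<Rightarrow> (real ^ 'n ^ 'm) set" where
  "plans E = {P. (\<forall>i j. 0 \<le> P $ i $ j) \<and> (\<forall>i j. (i, j) \<notin> E \<longrightarrow> P $ i $ j = 0) \<and>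
                 (\<Sum>i\<in>UNIV. \<Sum>j\<in>UNIV. P $ i $ j) = 1}"

definition X_marginal :: "('m \<times> 'n) set \<Rightarrow> real ^ 'n ^ 'm \<Rightarrow> real ^ 'm" where
  "X_marginal E P = (\<chi> i. \<Sum>j | (i, j) \<in> E. P $ i $ j)"

definition Y_marginal :: "('m \<times> 'n) set \<Rightarrow> real ^ 'n ^ 'm \<Rightarrow> real ^ 'n" where
  "Y_marginal E P = (\<chi> j. \<Sum>i | (i, j) \<in> E. P $ i $ j)"

text \<open>If \<open>\<mu>\<close> and \<open>\<nu>\<close> are positive and \<open>E\<close> leaves no vertex isolated, both minimizers below
  exist, are unique (the objective is strictly convex) and have positive entries.\<close>

definition mu_star :: "real ^ 'm \<Rightarrow> real ^ 'n \<Rightarrow> ('m \<times> 'n) set \<Rightarrow> real ^ 'm" where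
  "mu_star \<mu> \<nu> E = arg_min (\<lambda>\<mu>'. rel_entropy \<mu>' \<mu>)
     (\<lambda>\<mu>'. \<exists>Q\<in>plans E. X_marginal E Q = \<mu>' \<and> Y_marginal E Q = \<nu>)"

definition nu_star :: "real ^ 'm \<Rightarrow> real ^ 'n \<Rightarrow> ('m \<times> 'n) set \<Rightarrow> real ^ 'n" where
  "nu_star \<mu> \<nu> E = arg_min (\<lambda>\<nu>'. rel_entropy \<nu>' \<nu>)
     (\<lambda>\<nu>'. \<exists>P\<in>plans E. X_marginal E P = \<mu> \<and> Y_marginal E P = \<nu>')"

definition v_star :: "real ^ 'm \<Rightarrow> real ^ 'n \<Rightarrow> ('m \<times> 'n) set \<Rightarrow> real ^ 'm" where
  "v_star \<mu> \<nu> E = (\<chi> i. ln (\<mu> $ i / mu_star \<mu> \<nu> E $ i))"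

definition w_star :: "real ^ 'm \<Rightarrow> real ^ 'n \<Rightarrow> ('m \<times> 'n) set \<Rightarrow> real ^ 'n" where
  "w_star \<mu> \<nu> E = (\<chi> j. ln (\<nu> $ j / nu_star \<mu> \<nu> E $ j))"

text \<open>Costs take values in \<open>\<real> \<union> {\<infinity>}\<close>; the type \<^typ>\<open>ereal\<close> has the additional value \<open>-\<infinity>\<close>.\<close>

definition cost_on :: "('m \<times> 'n) set \<Rightarrow> ereal ^ 'n ^ 'm \<Rightarrow> bool" where
  "cost_on E C \<longleftrightarrow> (\<forall>i j. C $ i $ j \<noteq> -\<infinity>) \<and> {(i, j). C $ i $ j < \<infinity>} = E"

text \<open>The convention \<open>exp (-\<infinity>) = 0\<close>. The value at \<open>\<infinity>\<close> is arbitrary and is never used.\<close>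

definition exp_ereal :: "ereal \<Rightarrow> real" where
  "exp_ereal x = (if x = -\<infinity> then 0 else exp (real_of_ereal x))"

definition f_update :: "real ^ 'n \<Rightarrow> ereal ^ 'n ^ 'm \<Rightarrow> real \<Rightarrow> real ^ 'n \<Rightarrow> real ^ 'm" where
  "f_update \<nu> C \<tau> g =
     (\<chi> i. - \<tau> * ln (\<Sum>j\<in>UNIV. exp_ereal ((- (C $ i $ j) + ereal (g $ j)) / ereal \<tau>) * \<nu> $ j))"

definition g_update :: "real ^ 'm \<Rightarrow> ereal ^ 'n ^ 'm \<Rightarrow> real \<Rightarrow> real ^ 'm \<Rightarrow> real ^ 'n" where
  "g_update \<mu> C \<tau> f =
     (\<chi> j. - \<tau> * ln (\<Sum>i\<in>UNIV. exp_ereal ((- (C $ i $ j) + ereal (f $ i)) / ereal \<tau>) * \<mu> $ i))"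

primrec sinkhorn ::
  "real ^ 'm \<Rightarrow> real ^ 'n \<Rightarrow> ereal ^ 'n ^ 'm \<Rightarrow> real \<Rightarrow> real ^ 'm \<Rightarrow> real ^ 'n \<Rightarrow> nat \<Rightarrow>
   (real ^ 'm) \<times> (real ^ 'n)" where
  "sinkhorn \<mu> \<nu> C \<tau> f0 g0 0 = (f0, g0)"
| "sinkhorn \<mu> \<nu> C \<tau> f0 g0 (Suc k) =
     (let (f, g) = sinkhorn \<mu> \<nu> C \<tau> f0 g0 k
      in if even k then (f_update \<nu> C \<tau> g, g) else (f, g_update \<mu> C \<tau> f))"

definition sinkhorn_f ::
  "real ^ 'm \<Rightarrow> real ^ 'n \<Rightarrow> ereal ^ 'n ^ 'm \<Rightarrow> real \<Rightarrow> real ^ 'm \<Rightarrow> real ^ 'n \<Rightarrow> nat \<Rightarrow> real ^ 'm" where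
  "sinkhorn_f \<mu> \<nu> C \<tau> f0 g0 k = fst (sinkhorn \<mu> \<nu> C \<tau> f0 g0 k)"

definition sinkhorn_g ::
  "real ^ 'm \<Rightarrow> real ^ 'n \<Rightarrow> ereal ^ 'n ^ 'm \<Rightarrow> real \<Rightarrow> real ^ 'm \<Rightarrow> real ^ 'n \<Rightarrow> nat \<Rightarrow> real ^ 'n" where
  "sinkhorn_g \<mu> \<nu> C \<tau> f0 g0 k = snd (sinkhorn \<mu> \<nu> C \<tau> f0 g0 k)"

text \<open>The increments are meant for \<open>k \<ge> 1\<close> only; their values at \<open>0\<close> carry no meaning.\<close>

definition v_incr ::
  "real ^ 'm \<Rightarrow> real ^ 'n \<Rightarrow> ereal ^ 'n ^ 'm \<Rightarrow> real \<Rightarrow> real ^ 'm \<Rightarrow> real ^ 'n \<Rightarrow> nat \<Rightarrow> real ^ 'm" where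
  "v_incr \<mu> \<nu> C \<tau> f0 g0 k =
     (if k = 1 then (sinkhorn_f \<mu> \<nu> C \<tau> f0 g0 1 - sinkhorn_f \<mu> \<nu> C \<tau> f0 g0 0) /\<^sub>R \<tau>
      else (sinkhorn_f \<mu> \<nu> C \<tau> f0 g0 k - sinkhorn_f \<mu> \<nu> C \<tau> f0 g0 (k - 2)) /\<^sub>R \<tau>)"

definition w_incr ::
  "real ^ 'm \<Rightarrow> real ^ 'n \<Rightarrow> ereal ^ 'n ^ 'm \<Rightarrow> real \<Rightarrow> real ^ 'm \<Rightarrow> real ^ 'n \<Rightarrow> nat \<Rightarrow> real ^ 'n" where
  "w_incr \<mu> \<nu> C \<tau> f0 g0 k =
     (if k = 1 then 0
      else (sinkhorn_g \<mu> \<nu> C \<tau> f0 g0 k - sinkhorn_g \<mu> \<nu> C \<tau> f0 g0 (k - 2)) /\<^sub>R \<tau>)"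

definition logit ::
  "real ^ 'm \<Rightarrow> real ^ 'n \<Rightarrow> ereal ^ 'n ^ 'm \<Rightarrow> real \<Rightarrow> real ^ 'm \<Rightarrow> real ^ 'n \<Rightarrow> nat \<Rightarrow>
   ereal ^ 'n ^ 'm" where
  "logit \<mu> \<nu> C \<tau> f0 g0 k =
     (\<chi> i j. (ereal (sinkhorn_f \<mu> \<nu> C \<tau> f0 g0 k $ i) + ereal (sinkhorn_g \<mu> \<nu> C \<tau> f0 g0 k $ j)
              - C $ i $ j) / ereal \<tau>)"

text \<open>The indices where the limits of \<open>U\<^sup>2\<^sup>k\<close> and \<open>U\<^sup>2\<^sup>k\<^sup>+\<^sup>1\<close> in \<open>\<real> \<union> {-\<infinity>}\<close> are both finite. It is known
  that both limits exist, are finite at the same indices, and that the set of these indices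
  is the same for all costs with domain \<open>E\<close>, all \<open>\<tau> > 0\<close> and all initial values; the
  universal quantifier therefore does not single out a smaller set.\<close>

definition S_set :: "real ^ 'm \<Rightarrow> real ^ 'n \<Rightarrow> ('m \<times> 'n) set \<Rightarrow> ('m \<times> 'n) set" where
  "S_set \<mu> \<nu> E = {(i, j). \<forall>C \<tau> f0 g0. cost_on E C \<and> \<tau> > 0 \<longrightarrow>
     (\<exists>L::real. (\<lambda>k. logit \<mu> \<nu> C \<tau> f0 g0 (2 * k) $ i $ j) \<longlonglongrightarrow> ereal L) \<and>
     (\<exists>L::real. (\<lambda>k. logit \<mu> \<nu> C \<tau> f0 g0 (2 * k + 1) $ i $ j) \<longlonglongrightarrow> ereal L)}"

definition S_bar :: "real ^ 'm \<Rightarrow> real ^ 'n \<Rightarrow> ('m \<times> 'n) set \<Rightarrow> ('m \<times> 'n) set" where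
  "S_bar \<mu> \<nu> E = {(i, j) \<in> E. v_star \<mu> \<nu> E $ i + w_star \<mu> \<nu> E $ j = 0}"

end

theory Submission
  imports Defs
begin

text \<open>
  Write \<open>P = exp U * \<mu> * \<nu>\<close> for the plan of a matrix \<open>U\<close> of logits. A half-step of the algorithm adds
  to \<open>U\<close> the logarithm of the prescribed marginal divided by the current marginal, in all rows or in
  all columns, and these logarithms are the increments \<open>v\<^sup>k\<close> and \<open>w\<^sup>k\<close>. So the question is how fast the
  marginals of the plans converge, although the logits may diverge.

  The limits \<open>v\<close>, \<open>w\<close> of the increments satisfy \<open>v i + w j \<le> 0\<close> on \<open>E\<close>, with equality on the edges
  charged by a plan \<open>Q\<close> that has the marginals \<open>\<mu>\<close> and \<open>\<nu> exp (- w)\<close>. Such an equilibrium exists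
  (\<open>equilibrium_exists\<close>) and yields both entropy minimisers (\<open>star_eq_equilibrium\<close>). The key quantity is
  the \<open>Q\<close>-average \<open>A\<close> of the logits. The drift \<open>v i + w j\<close> vanishes where \<open>Q\<close> lives, so \<open>A\<close> does not see
  the divergence; it increases in every sweep by at least the relative entropies that measure the marginal
  errors (\<open>mean_logit_sweep\<close>); and it is bounded above, because the entries of a plan are at most \<open>1\<close>. Its total
  increase is of order \<open>1 + \<delta>\<close>. Three facts follow.

  The first: if \<open>Q\<close> charges all tight edges, that is, those with \<open>v i + w j = 0\<close>, then the tight
  logits never fall below \<open>- R (1 + \<delta>)\<close> (\<open>logit_lower\<close>). Such a \<open>Q\<close> is found as a cluster point of the
  plans of one run of the algorithm, and it charges every tight edge exactly because the logits on these
  edges are assumed to converge (\<open>full_plan_of_convergent_logits\<close>).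

  The second: on the other edges the logits tend to \<open>- \<infinity>\<close> at a linear rate, up to a term of order
  \<open>1 + \<delta>\<close>, since finite total dissipation leaves the drift dominant (\<open>logit_drift\<close>). After a time of order
  \<open>1 + \<delta>\<close> the mass on these edges decays exponentially.

  The third: on the tight edges the dual objective is strongly concave with a modulus of order
  \<open>exp (- R (1 + \<delta>))\<close>, so the remaining increase of \<open>A\<close> is at most \<open>exp (R (1 + \<delta>))\<close> times the increase
  in the next sweep plus the mass outside the tight edges (\<open>ascent_bounds_gap\<close>).

  Hence the remaining increase of \<open>A\<close> contracts by the factor \<open>1 - exp (- R (1 + \<delta>))\<close> up to an
  exponentially small perturbation (\<open>perturbed_contraction_decay\<close>). It dominates the entropies of the
  marginal errors, hence the errors of the increments themselves (\<open>linear_convergence\<close>).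
\<close>

section \<open>Entropy and convexity estimates\<close>

text \<open>The Bregman distance of \<open>exp\<close> between \<open>- y\<close> and \<open>0\<close>. For weights \<open>p\<close>, \<open>q\<close> of equal mass, the relative entropy
  of \<open>p\<close> with respect to \<open>q\<close> is the \<open>p\<close>-average of \<open>excess (ln (p / q))\<close>; entropy dissipation along
  the algorithm is therefore a weighted sum of excesses of logarithmic marginal errors.\<close>

definition excess :: "real \<Rightarrow> real" where
  "excess y = y - 1 + exp (- y)"

lemma excess_nonneg: "0 \<le> excess y"
  unfolding excess_def using exp_ge_add_one_self[of "- y"] by linarith

text \<open>The graph of the convex function \<open>excess\<close> lies above its tangent at \<open>\<eta>\<close>. Summed over the
  iterations this says that finite total dissipation allows positive errors to grow at most at the
  small linear rate \<open>\<eta>\<close>, up to a bounded amount.\<close>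

lemma excess_tangent:
  assumes "0 < \<eta>"
  shows "y \<le> \<eta> + excess y / (1 - exp (- \<eta>))"
proof -
  have pos: "0 < 1 - exp (- \<eta>)" using assms by simp
  have "1 + (\<eta> - y) \<le> exp (\<eta> - y)" by (rule exp_ge_add_one_self)
  then have "exp (- \<eta>) * (1 + (\<eta> - y)) \<le> exp (- \<eta>) * exp (\<eta> - y)"
    by (intro mult_left_mono) auto
  also have "\<dots> = exp (- y)" by (simp flip: exp_add)
  finally have "(y - \<eta>) * (1 - exp (- \<eta>)) \<le> excess y - excess \<eta>"
    unfolding excess_def by (simp add: algebra_simps)
  with excess_nonneg[of \<eta>] have "(y - \<eta>) * (1 - exp (- \<eta>)) \<le> excess y" by linarith
  then have "y - \<eta> \<le> excess y / (1 - exp (- \<eta>))" using pos by (simp add: pos_le_divide_eq)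
  then show ?thesis by simp
qed

text \<open>A Hellinger-type lower bound, from \<open>2 exp (- y / 2) \<ge> 2 - y\<close>; it gives the two quadratic bounds
  that follow without any second-order Taylor estimate.\<close>

lemma excess_ge_sqrt_deviation: "(exp (- y / 2) - 1)\<^sup>2 \<le> excess y"
proof -
  have "exp (- y) = (exp (- y / 2))\<^sup>2" by (simp add: power2_eq_square flip: exp_add)
  then show ?thesis
    unfolding excess_def using exp_ge_add_one_self[of "- y / 2"]
    by (simp add: power2_eq_square algebra_simps)
qed

lemma excess_ge_deviation:
  assumes "exp (- y) \<le> Z"
  shows "(exp (- y) - 1)\<^sup>2 \<le> 2 * (1 + Z) * excess y"
proof -
  define s where "s = exp (- y / 2)"
  have sq: "exp (- y) = s\<^sup>2" by (simp add: s_def power2_eq_square flip: exp_add)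
  have "(s + 1)\<^sup>2 \<le> 2 * (1 + s\<^sup>2)"
    using zero_le_power2[of "s - 1"] by (simp add: power2_eq_square algebra_simps)
  also have "\<dots> \<le> 2 * (1 + Z)" using assms sq by simp
  finally have "(s + 1)\<^sup>2 * (s - 1)\<^sup>2 \<le> 2 * (1 + Z) * excess y"
    using excess_ge_sqrt_deviation[of y] order_trans[OF exp_ge_zero assms]
    by (intro mult_mono) (auto simp: s_def)
  moreover have "(exp (- y) - 1)\<^sup>2 = (s + 1)\<^sup>2 * (s - 1)\<^sup>2"
    unfolding sq by (simp add: power2_eq_square algebra_simps)
  ultimately show ?thesis by simp
qed

lemma abs_le_of_excess_le:
  assumes "excess y \<le> g"
  shows "\<bar>y\<bar> \<le> 4 * sqrt g + g"
proof -
  have g0: "0 \<le> g" using assms excess_nonneg[of y] by linarith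
  have "(exp (- y / 2) - 1)\<^sup>2 \<le> g" using assms excess_ge_sqrt_deviation[of y] by linarith
  then have dev: "\<bar>exp (- y / 2) - 1\<bar> \<le> sqrt g" using real_le_rsqrt by fastforce
  show ?thesis
  proof (cases "y \<le> 0")
    case True
    have "- y / 2 \<le> sqrt g" using dev exp_ge_add_one_self[of "- y / 2"] by linarith
    then show ?thesis using True g0 by simp
  next
    case False
    show ?thesis
    proof (cases "sqrt g \<le> 1 / 2")
      case True
      have "(1 + y / 2) * exp (- y / 2) \<le> exp (y / 2) * exp (- y / 2)"
        using exp_ge_add_one_self[of "y / 2"] by (intro mult_right_mono) auto
      also have "\<dots> = 1" by (simp flip: exp_add)
      finally have 1: "(1 + y / 2) * exp (- y / 2) \<le> 1" .
      have "(y / 2) * (1 / 2) \<le> (y / 2) * exp (- y / 2)"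
        using False dev True by (intro mult_left_mono) auto
      also have "\<dots> \<le> sqrt g" using 1 dev by (simp add: algebra_simps)
      finally show ?thesis using False g0 by simp
    next
      case sg: False
      have "y \<le> 1 + g" using assms unfolding excess_def
        using exp_gt_zero[of "- y"] by linarith
      then show ?thesis using False sg by simp
    qed
  qed
qed

text \<open>Strong convexity of \<open>exp\<close>, with the modulus expressed by the smaller of the values at the two
  end points \<open>0\<close> and \<open>d\<close>: applied to a plan, the modulus is the smaller of two plan entries.\<close>

lemma exp_ge_quadratic: "1 + d + d\<^sup>2 / 2 * min 1 (exp d) \<le> exp (d::real)"
proof (cases "0 \<le> d")
  case True
  then show ?thesis using exp_lower_Taylor_quadratic[OF True] by (simp add: min_def)
next
  case False
  define s where "s = - d"
  have s: "0 \<le> s" using False s_def by simp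
  let ?F = "\<lambda>s. s * exp s - exp s - s\<^sup>2 / (2::real)"
  have "?F 0 \<le> ?F s"
  proof (rule DERIV_nonneg_imp_nondecreasing[OF s])
    fix x :: real assume "0 \<le> x" "x \<le> s"
    have "(?F has_real_derivative x * exp x - x) (at x)"
      by (auto intro!: derivative_eq_intros)
    moreover have "0 \<le> x * exp x - x"
      using \<open>0 \<le> x\<close> mult_left_mono[of 1 "exp x" x] by simp
    ultimately show "\<exists>y. (?F has_real_derivative y) (at x) \<and> 0 \<le> y" by blast
  qed
  then have "s\<^sup>2 / 2 \<le> 1 + s * exp s - exp s" by simp
  then have "exp (- s) * (s\<^sup>2 / 2) \<le> exp (- s) * (1 + s * exp s - exp s)"
    by (intro mult_left_mono) auto
  also have "\<dots> = exp (- s) + s - 1" by (simp add: algebra_simps flip: exp_add)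
  finally show ?thesis using False by (simp add: s_def min_def mult.commute)
qed

lemma linear_minus_quadratic_le:
  fixes D e p G :: real assumes "0 < p"
  shows "G * D * e - p / 2 * D\<^sup>2 \<le> G\<^sup>2 * e\<^sup>2 / (2 * p)"
proof -
  have "0 \<le> (G * e - p * D)\<^sup>2 / (2 * p)" using assms by simp
  also have "(G * e - p * D)\<^sup>2 / (2 * p) = G\<^sup>2 * e\<^sup>2 / (2 * p) - (G * D * e - p / 2 * D\<^sup>2)"
    using assms by (simp add: field_simps power2_eq_square)
  finally show ?thesis by simp
qed

lemma sum_pairing:
  fixes P :: "'a::finite \<Rightarrow> 'b::finite \<Rightarrow> real"
  shows "(\<Sum>i\<in>UNIV. \<Sum>j\<in>UNIV. P i j * (a i + b j)) =
    (\<Sum>i\<in>UNIV. (\<Sum>j\<in>UNIV. P i j) * a i) + (\<Sum>j\<in>UNIV. (\<Sum>i\<in>UNIV. P i j) * b j)"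
proof -
  have "(\<Sum>i\<in>UNIV. \<Sum>j\<in>UNIV. P i j * b j) = (\<Sum>j\<in>UNIV. \<Sum>i\<in>UNIV. P i j * b j)"
    by (rule sum.swap)
  then show ?thesis by (simp add: distrib_left sum.distrib sum_distrib_right)
qed

lemma term_le_double_sum:
  fixes P :: "'a::finite \<Rightarrow> 'b::finite \<Rightarrow> real"
  assumes "\<And>i j. 0 \<le> P i j"
  shows "P i j \<le> (\<Sum>i\<in>UNIV. \<Sum>j\<in>UNIV. P i j)"
proof -
  have "P i j \<le> (\<Sum>j\<in>UNIV. P i j)" using assms by (intro member_le_sum) auto
  also have "\<dots> \<le> (\<Sum>i\<in>UNIV. \<Sum>j\<in>UNIV. P i j)"
    using assms by (intro member_le_sum[of i UNIV "\<lambda>i. \<Sum>j\<in>UNIV. P i j"]) (auto intro: sum_nonneg)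
  finally show ?thesis .
qed

section \<open>Potentials in a bounded gauge\<close>

text \<open>The logits on \<open>S\<close> determine the potentials only up to a constant on each connected component of
  the graph \<open>S\<close>. The map from potentials to logits is linear between finite-dimensional spaces, hence
  has a bounded linear right inverse on its range, which selects a gauge with small potentials.\<close>

lemma bounded_potentials:
  fixes S :: "('m::finite \<times> 'n::finite) set"
  obtains \<Gamma> :: real where "0 < \<Gamma>"
    and "\<And>a b D. (\<And>i j. (i, j) \<in> S \<Longrightarrow> \<bar>a i + b j\<bar> \<le> D) \<Longrightarrow> 0 \<le> D \<Longrightarrow>
      \<exists>a' b'. (\<forall>i j. (i, j) \<in> S \<longrightarrow> a' i + b' j = a i + b j) \<and>
        (\<forall>i. \<bar>a' i\<bar> \<le> \<Gamma> * D) \<and> (\<forall>j. \<bar>b' j\<bar> \<le> \<Gamma> * D)"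
proof -
  define L :: "(real ^ 'm) \<times> (real ^ 'n) \<Rightarrow> real ^ 'n ^ 'm" where
    "L x = (\<chi> i j. if (i, j) \<in> S then fst x $ i + snd x $ j else 0)" for x
  have "linear L"
    by (rule linearI) (auto simp: L_def vec_eq_iff algebra_simps)
  from linear_exists_right_inverse_on[OF this subspace_UNIV]
  obtain G where G: "linear G" "\<And>x. L (G (L x)) = L x" by auto
  from G(1) have "bounded_linear G" by (simp add: linear_conv_bounded_linear)
  then obtain K where K: "0 < K" "\<And>y. norm (G y) \<le> norm y * K"
    using bounded_linear.pos_bounded by blast
  define N where "N = real CARD('m) * real CARD('n)"
  have N: "0 < N" unfolding N_def by simp
  show thesis
  proof (rule that[of "K * N"])
    show "0 < K * N" using K N by simp
  next
    fix a :: "'m \<Rightarrow> real" and b :: "'n \<Rightarrow> real" and D :: real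
    assume ab: "\<And>i j. (i, j) \<in> S \<Longrightarrow> \<bar>a i + b j\<bar> \<le> D" and D: "0 \<le> D"
    define y where "y = L (\<chi> i. a i, \<chi> j. b j)"
    have yij: "y $ i $ j = (if (i, j) \<in> S then a i + b j else 0)" for i j
      by (simp add: y_def L_def)
    have "norm y \<le> (\<Sum>i\<in>UNIV. norm (y $ i))" unfolding norm_vec_def by (rule L2_set_le_sum) auto
    also have "\<dots> \<le> (\<Sum>i\<in>(UNIV::'m set). \<Sum>j\<in>(UNIV::'n set). D)"
    proof (rule sum_mono)
      fix i
      have "norm (y $ i) \<le> (\<Sum>j\<in>UNIV. norm (y $ i $ j))"
        unfolding norm_vec_def by (rule L2_set_le_sum) auto
      also have "\<dots> \<le> (\<Sum>j\<in>(UNIV::'n set). D)" using ab D by (intro sum_mono) (auto simp: yij)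
      finally show "norm (y $ i) \<le> (\<Sum>j\<in>(UNIV::'n set). D)" .
    qed
    also have "\<dots> = N * D" by (simp add: N_def)
    finally have "norm y * K \<le> N * D * K" using K by (intro mult_right_mono) auto
    then have nG: "norm (G y) \<le> K * N * D" using K(2)[of y] by (simp add: mult.commute mult.left_commute)
    have LG: "L (G y) = y" unfolding y_def by (rule G)
    show "\<exists>a' b'. (\<forall>i j. (i, j) \<in> S \<longrightarrow> a' i + b' j = a i + b j) \<and>
        (\<forall>i. \<bar>a' i\<bar> \<le> K * N * D) \<and> (\<forall>j. \<bar>b' j\<bar> \<le> K * N * D)"
    proof (intro exI conjI allI impI)
      fix i j assume "(i, j) \<in> S"
      then show "fst (G y) $ i + snd (G y) $ j = a i + b j"
        using arg_cong[OF LG, of "\<lambda>z. z $ i $ j"] by (simp add: yij) (simp add: L_def)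
    next
      fix i show "\<bar>fst (G y) $ i\<bar> \<le> K * N * D"
        using component_le_norm_cart[of "fst (G y)" i] norm_fst_le[of "fst (G y)" "snd (G y)"] nG by simp
    next
      fix j show "\<bar>snd (G y) $ j\<bar> \<le> K * N * D"
        using component_le_norm_cart[of "snd (G y)" j] norm_snd_le[of "snd (G y)" "fst (G y)"] nG by simp
    qed
  qed
qed

section \<open>Alternating normalisation on a graph\<close>

locale weighted_graph =
  fixes \<mu> :: "'m::finite \<Rightarrow> real" and \<nu> :: "'n::finite \<Rightarrow> real" and E :: "('m \<times> 'n) set"
  assumes mu_pos: "0 < \<mu> i" and nu_pos: "0 < \<nu> j"
    and sum_mu: "(\<Sum>i\<in>UNIV. \<mu> i) = 1" and sum_nu: "(\<Sum>j\<in>UNIV. \<nu> j) = 1"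
    and row_nonempty: "\<exists>j. (i, j) \<in> E" and col_nonempty: "\<exists>i. (i, j) \<in> E"
begin

definition plan :: "('m \<Rightarrow> 'n \<Rightarrow> real) \<Rightarrow> 'm \<Rightarrow> 'n \<Rightarrow> real" where
  "plan U i j = (if (i, j) \<in> E then exp (U i j) * \<mu> i * \<nu> j else 0)"

definition row_incr :: "('m \<Rightarrow> 'n \<Rightarrow> real) \<Rightarrow> 'm \<Rightarrow> real" where
  "row_incr U i = ln (\<mu> i / (\<Sum>j\<in>UNIV. plan U i j))"

definition col_incr :: "('m \<Rightarrow> 'n \<Rightarrow> real) \<Rightarrow> 'n \<Rightarrow> real" where
  "col_incr U j = ln (\<nu> j / (\<Sum>i\<in>UNIV. plan U i j))"

definition row_step :: "('m \<Rightarrow> 'n \<Rightarrow> real) \<Rightarrow> 'm \<Rightarrow> 'n \<Rightarrow> real" where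
  "row_step U i j = U i j + row_incr U i"

definition col_step :: "('m \<Rightarrow> 'n \<Rightarrow> real) \<Rightarrow> 'm \<Rightarrow> 'n \<Rightarrow> real" where
  "col_step U i j = U i j + col_incr U j"

text \<open>Sweeps always start from a row-normalised state. One such sweep advances the algorithm from an odd
  iteration to the next odd one, so the initial row step is kept apart from the sweeps.\<close>

definition sweep :: "('m \<Rightarrow> 'n \<Rightarrow> real) \<Rightarrow> 'm \<Rightarrow> 'n \<Rightarrow> real" where
  "sweep U = row_step (col_step U)"

definition row_normalised :: "('m \<Rightarrow> 'n \<Rightarrow> real) \<Rightarrow> bool" where
  "row_normalised U \<longleftrightarrow> (\<forall>i. (\<Sum>j\<in>UNIV. plan U i j) = \<mu> i)"

lemma plan_nonneg: "0 \<le> plan U i j"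
  using mu_pos[of i] nu_pos[of j] by (simp add: plan_def)

lemma plan_pos: "(i, j) \<in> E \<Longrightarrow> 0 < plan U i j"
  using mu_pos[of i] nu_pos[of j] by (simp add: plan_def)

lemma plan_off: "(i, j) \<notin> E \<Longrightarrow> plan U i j = 0"
  by (simp add: plan_def)

lemma row_sum_pos: "0 < (\<Sum>j\<in>UNIV. plan U i j)"
proof -
  obtain j where "(i, j) \<in> E" using row_nonempty by blast
  then show ?thesis using plan_pos plan_nonneg by (intro sum_pos2[of _ j]) auto
qed

lemma col_sum_pos: "0 < (\<Sum>i\<in>UNIV. plan U i j)"
proof -
  obtain i where "(i, j) \<in> E" using col_nonempty by blast
  then show ?thesis using plan_pos plan_nonneg by (intro sum_pos2[of _ i]) auto
qed

lemma plan_row_step: "plan (row_step U) i j = plan U i j * (\<mu> i / (\<Sum>j\<in>UNIV. plan U i j))"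
  using row_sum_pos[of U i] mu_pos[of i]
  by (simp add: plan_def row_step_def row_incr_def exp_add)

lemma plan_col_step: "plan (col_step U) i j = plan U i j * (\<nu> j / (\<Sum>i\<in>UNIV. plan U i j))"
  using col_sum_pos[of U j] nu_pos[of j]
  by (simp add: plan_def col_step_def col_incr_def exp_add)

lemma row_sum_row_step: "(\<Sum>j\<in>UNIV. plan (row_step U) i j) = \<mu> i"
  using row_sum_pos[of U i] unfolding plan_row_step sum_distrib_right[symmetric] by simp

lemma col_sum_col_step: "(\<Sum>i\<in>UNIV. plan (col_step U) i j) = \<nu> j"
  using col_sum_pos[of U j] unfolding plan_col_step sum_distrib_right[symmetric] by simp

lemma row_normalised_row_step: "row_normalised (row_step U)"
  unfolding row_normalised_def by (simp add: row_sum_row_step)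

lemma row_normalised_orbit:
  assumes "row_normalised U"
  shows "row_normalised ((sweep ^^ t) U)"
  using assms row_normalised_row_step by (cases t) (auto simp: sweep_def)

lemma total_mass: "row_normalised U \<Longrightarrow> (\<Sum>i\<in>UNIV. \<Sum>j\<in>UNIV. plan U i j) = 1"
  by (simp add: row_normalised_def sum_mu)

lemma logit_upper:
  assumes "row_normalised U" and "(i, j) \<in> E"
  shows "U i j \<le> - ln (\<nu> j)"
proof -
  have "plan U i j \<le> (\<Sum>j\<in>UNIV. plan U i j)" using plan_nonneg by (intro member_le_sum) auto
  then have "exp (U i j) * \<mu> i * \<nu> j \<le> \<mu> i" using assms by (simp add: row_normalised_def plan_def)
  then have "exp (U i j) * \<nu> j \<le> 1" using mu_pos[of i] by (simp add: mult.assoc mult.left_commute[of _ "\<mu> i"])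
  then have "exp (U i j) \<le> 1 / \<nu> j" using nu_pos[of j] by (simp add: field_simps)
  then have "ln (exp (U i j)) \<le> ln (1 / \<nu> j)" by (subst ln_le_cancel_iff) (use nu_pos[of j] in auto)
  then show ?thesis using nu_pos[of j] by (simp add: ln_div)
qed

lemma sweep_apply: "sweep U i j = U i j + col_incr U j + row_incr (col_step U) i"
  by (simp add: sweep_def row_step_def[of "col_step U"] col_step_def)

text \<open>Comparing a state with a later one of its orbit is a finite-dimensional concave problem in
  the potentials \<open>a\<close>, \<open>b\<close>; this is how the distance to the limit enters \<open>ascent_bounds_gap\<close> below.\<close>

lemma orbit_difference:
  "\<exists>a b. \<forall>i j. (sweep ^^ (t + s)) U i j = (sweep ^^ t) U i j + (a i + b j)"
proof (induction s)
  case 0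
  show ?case by (rule exI[of _ "\<lambda>_. 0"], rule exI[of _ "\<lambda>_. 0"]) simp
next
  case (Suc s)
  let ?V = "(sweep ^^ (t + s)) U"
  from Suc obtain a b where ab: "\<forall>i j. ?V i j = (sweep ^^ t) U i j + (a i + b j)" by blast
  show ?case
    by (rule exI[of _ "\<lambda>i. a i + row_incr (col_step ?V) i"], rule exI[of _ "\<lambda>j. b j + col_incr ?V j"])
      (use ab in \<open>simp add: sweep_apply[of ?V]\<close>)
qed

lemma row_step_lower:
  assumes "\<And>i j. (i, j) \<in> E \<Longrightarrow> \<bar>U i j\<bar> \<le> \<delta>" and "(i, j) \<in> E"
  shows "- (2 * \<delta>) \<le> row_step U i j"
proof -
  have "(\<Sum>j\<in>UNIV. plan U i j) \<le> (\<Sum>j\<in>UNIV. exp \<delta> * \<mu> i * \<nu> j)"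
  proof (rule sum_mono)
    fix j'
    have "\<bar>U i j'\<bar> \<le> \<delta>" if "(i, j') \<in> E" using assms(1) that .
    then show "plan U i j' \<le> exp \<delta> * \<mu> i * \<nu> j'"
      using mu_pos[of i] nu_pos[of j'] by (auto simp: plan_def)
  qed
  also have "\<dots> = exp \<delta> * \<mu> i" by (simp add: sum_distrib_left[symmetric] sum_nu)
  finally have "\<mu> i / (\<Sum>j\<in>UNIV. plan U i j) \<ge> exp (- \<delta>)"
    using row_sum_pos[of U i] by (simp add: exp_minus field_simps)
  then have "ln (exp (- \<delta>)) \<le> row_incr U i" unfolding row_incr_def
    by (subst ln_le_cancel_iff) (use mu_pos[of i] row_sum_pos[of U i] in auto)
  moreover have "- \<delta> \<le> U i j" using assms(1)[OF assms(2)] by linarith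
  ultimately show ?thesis by (simp add: row_step_def)
qed

end

section \<open>Equilibrium and entropy ascent\<close>

text \<open>The certificate for the limits of the increments: a drift \<open>v i + w j\<close> that is nonpositive on the
  edges, together with a plan that only charges edges without drift and whose marginals are \<open>\<mu>\<close> and
  \<open>\<nu> exp (- w)\<close> (the predicate \<open>equilibrium_plan\<close> below). These are the optimality conditions for both
  entropy minimisations at once, as \<open>star_eq_equilibrium\<close> shows.\<close>

locale equilibrium = weighted_graph \<mu> \<nu> E
  for \<mu> :: "'m::finite \<Rightarrow> real" and \<nu> :: "'n::finite \<Rightarrow> real" and E +
  fixes v :: "'m \<Rightarrow> real" and w :: "'n \<Rightarrow> real"
  assumes drift_nonpos: "(i, j) \<in> E \<Longrightarrow> v i + w j \<le> 0"
begin

definition tight :: "('m \<times> 'n) set" where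
  "tight = {(i, j) \<in> E. v i + w j = 0}"

definition nu_eq :: "'n \<Rightarrow> real" where
  "nu_eq j = \<nu> j * exp (- w j)"

definition equilibrium_plan :: "('m \<Rightarrow> 'n \<Rightarrow> real) \<Rightarrow> bool" where
  "equilibrium_plan Q \<longleftrightarrow> (\<forall>i j. 0 \<le> Q i j) \<and> (\<forall>i j. (i, j) \<notin> tight \<longrightarrow> Q i j = 0) \<and>
     (\<forall>i. (\<Sum>j\<in>UNIV. Q i j) = \<mu> i) \<and> (\<forall>j. (\<Sum>i\<in>UNIV. Q i j) = nu_eq j)"

text \<open>For an equilibrium plan \<open>Q\<close> and row-normalised states this is, up to a constant, the dual objective
  of the entropic transport problem between the marginals \<open>\<mu>\<close> and \<open>nu_eq\<close>, and it is the
  Lyapunov function of the whole argument.\<close>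

definition mean_logit :: "('m \<Rightarrow> 'n \<Rightarrow> real) \<Rightarrow> ('m \<Rightarrow> 'n \<Rightarrow> real) \<Rightarrow> real" where
  "mean_logit Q U = (\<Sum>i\<in>UNIV. \<Sum>j\<in>UNIV. Q i j * U i j)"

definition row_dev :: "('m \<Rightarrow> 'n \<Rightarrow> real) \<Rightarrow> 'm \<Rightarrow> real" where
  "row_dev U i = row_incr (col_step U) i - v i"

definition col_dev :: "('m \<Rightarrow> 'n \<Rightarrow> real) \<Rightarrow> 'n \<Rightarrow> real" where
  "col_dev U j = col_incr U j - w j"

lemma nu_eq_pos: "0 < nu_eq j"
  using nu_pos[of j] by (simp add: nu_eq_def)

lemma sweep_eq: "sweep U i j = U i j + ((v i + w j) + (row_dev U i + col_dev U j))"
  by (simp add: sweep_apply row_dev_def col_dev_def)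

lemma exp_col_dev: "nu_eq j * exp (- col_dev U j) = (\<Sum>i\<in>UNIV. plan U i j)"
  using col_sum_pos[of U j] nu_pos[of j]
  by (simp add: nu_eq_def col_dev_def col_incr_def exp_diff exp_minus)

lemma exp_row_dev:
  "\<mu> i * exp (- row_dev U i) = exp (v i) * (\<Sum>j\<in>UNIV. plan (col_step U) i j)"
  using row_sum_pos[of "col_step U" i] mu_pos[of i]
  by (simp add: row_dev_def row_incr_def exp_diff exp_minus)

lemma sum_nu_eq:
  assumes "equilibrium_plan Q" shows "(\<Sum>j\<in>UNIV. nu_eq j) = 1"
proof -
  have "(\<Sum>j\<in>UNIV. nu_eq j) = (\<Sum>j\<in>UNIV. \<Sum>i\<in>UNIV. Q i j)" using assms by (simp add: equilibrium_plan_def)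
  also have "\<dots> = (\<Sum>i\<in>UNIV. \<Sum>j\<in>UNIV. Q i j)" by (rule sum.swap)
  also have "\<dots> = 1" using assms by (simp add: equilibrium_plan_def sum_mu)
  finally show ?thesis .
qed

lemma mean_logit_pairing:
  assumes "equilibrium_plan Q"
  shows "mean_logit Q (\<lambda>i j. a i + b j) = (\<Sum>i\<in>UNIV. \<mu> i * a i) + (\<Sum>j\<in>UNIV. nu_eq j * b j)"
  using assms unfolding mean_logit_def sum_pairing by (simp add: equilibrium_plan_def)

text \<open>The plan only charges tight edges, so the linear drift of the logits is invisible to
  \<open>mean_logit Q\<close>. This is why the functional stays bounded although the potentials diverge.\<close>

lemma mean_logit_drift:
  assumes "equilibrium_plan Q"
  shows "mean_logit Q (\<lambda>i j. v i + w j) = 0"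
proof -
  have "Q i j * (v i + w j) = 0" for i j
    using assms by (cases "(i, j) \<in> tight") (auto simp: equilibrium_plan_def tight_def)
  then show ?thesis unfolding mean_logit_def by (intro sum.neutral ballI)
qed

lemma mean_logit_add: "mean_logit Q (\<lambda>i j. U i j + V i j) = mean_logit Q U + mean_logit Q V"
  by (simp add: mean_logit_def distrib_left sum.distrib)

lemma equilibrium_plan_mass:
  assumes "equilibrium_plan Q" shows "(\<Sum>i\<in>UNIV. \<Sum>j\<in>UNIV. Q i j) = 1"
  using assms by (simp add: equilibrium_plan_def sum_mu)

text \<open>The ascent estimate. By duality the functional grows by the averages of the row and column errors.
  The mass balance turns the column average into an average of excesses exactly; for the rows,
  \<open>v i \<le> - w j\<close> on \<open>E\<close> gives the missing inequality.\<close>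

lemma mean_logit_sweep:
  assumes Q: "equilibrium_plan Q" and U: "row_normalised U"
  shows "mean_logit Q U + ((\<Sum>i\<in>UNIV. \<mu> i * excess (row_dev U i)) + (\<Sum>j\<in>UNIV. nu_eq j * excess (col_dev U j)))
    \<le> mean_logit Q (sweep U)"
proof -
  have "mean_logit Q (sweep U) = mean_logit Q (\<lambda>i j. U i j + ((v i + w j) + (row_dev U i + col_dev U j)))"
    by (simp add: sweep_eq[abs_def] mean_logit_def sweep_eq)
  also have "\<dots> = mean_logit Q U + ((\<Sum>i\<in>UNIV. \<mu> i * row_dev U i) + (\<Sum>j\<in>UNIV. nu_eq j * col_dev U j))"
    using mean_logit_add[of Q U "\<lambda>i j. (v i + w j) + (row_dev U i + col_dev U j)"]
      mean_logit_add[of Q "\<lambda>i j. v i + w j" "\<lambda>i j. row_dev U i + col_dev U j"]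
      mean_logit_drift[OF Q] mean_logit_pairing[OF Q, of "row_dev U" "col_dev U"] by simp
  finally have 1: "mean_logit Q (sweep U) =
    mean_logit Q U + ((\<Sum>i\<in>UNIV. \<mu> i * row_dev U i) + (\<Sum>j\<in>UNIV. nu_eq j * col_dev U j))" .
  have "(\<Sum>j\<in>UNIV. nu_eq j * exp (- col_dev U j)) = (\<Sum>j\<in>UNIV. \<Sum>i\<in>UNIV. plan U i j)"
    by (simp add: exp_col_dev)
  also have "\<dots> = 1" using total_mass[OF U] by (subst sum.swap)
  finally have 2: "(\<Sum>j\<in>UNIV. nu_eq j * excess (col_dev U j)) = (\<Sum>j\<in>UNIV. nu_eq j * col_dev U j)"
    using sum_nu_eq[OF Q] by (simp add: excess_def algebra_simps sum.distrib sum_subtractf)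
  have "(\<Sum>i\<in>UNIV. \<mu> i * exp (- row_dev U i)) = (\<Sum>i\<in>UNIV. \<Sum>j\<in>UNIV. exp (v i) * plan (col_step U) i j)"
    by (simp add: exp_row_dev sum_distrib_left)
  also have "\<dots> \<le> (\<Sum>i\<in>UNIV. \<Sum>j\<in>UNIV. exp (- w j) * plan (col_step U) i j)"
  proof (intro sum_mono)
    fix i j
    show "exp (v i) * plan (col_step U) i j \<le> exp (- w j) * plan (col_step U) i j"
    proof (cases "(i, j) \<in> E")
      case True
      then show ?thesis using drift_nonpos[OF True] plan_nonneg by (intro mult_right_mono) auto
    qed (simp add: plan_def)
  qed
  also have "\<dots> = (\<Sum>j\<in>UNIV. exp (- w j) * (\<Sum>i\<in>UNIV. plan (col_step U) i j))"
    unfolding sum_distrib_left by (rule sum.swap)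
  also have "\<dots> = 1" using sum_nu_eq[OF Q] by (simp add: col_sum_col_step nu_eq_def mult.commute)
  finally have 3: "(\<Sum>i\<in>UNIV. \<mu> i * excess (row_dev U i)) \<le> (\<Sum>i\<in>UNIV. \<mu> i * row_dev U i)"
    using sum_mu by (simp add: excess_def algebra_simps sum.distrib sum_subtractf)
  show ?thesis using 1 2 3 by linarith
qed

lemma excess_sums_nonneg:
  "0 \<le> (\<Sum>i\<in>UNIV. \<mu> i * excess (row_dev U i))" "0 \<le> (\<Sum>j\<in>UNIV. nu_eq j * excess (col_dev U j))"
  by (auto intro!: sum_nonneg mult_nonneg_nonneg excess_nonneg simp: less_imp_le[OF mu_pos] less_imp_le[OF nu_eq_pos])

lemma mean_logit_mono_orbit:
  assumes Q: "equilibrium_plan Q" and U: "row_normalised U" and "s \<le> t"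
  shows "mean_logit Q ((sweep ^^ s) U) \<le> mean_logit Q ((sweep ^^ t) U)"
proof (rule lift_Suc_mono_le[OF _ \<open>s \<le> t\<close>, of "\<lambda>t. mean_logit Q ((sweep ^^ t) U)"])
  fix n show "mean_logit Q ((sweep ^^ n) U) \<le> mean_logit Q ((sweep ^^ Suc n) U)"
    using mean_logit_sweep[OF Q row_normalised_orbit[OF U, of n]] excess_sums_nonneg[of "(sweep ^^ n) U"]
    by simp
qed

lemma mean_logit_le:
  assumes Q: "equilibrium_plan Q" and c: "\<And>i j. (i, j) \<in> E \<Longrightarrow> U i j \<le> c"
  shows "mean_logit Q U \<le> c"
proof -
  have "mean_logit Q U \<le> (\<Sum>i\<in>UNIV. \<Sum>j\<in>UNIV. Q i j * c)" unfolding mean_logit_def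
  proof (intro sum_mono)
    fix i j show "Q i j * U i j \<le> Q i j * c"
      using Q c by (cases "(i, j) \<in> tight") (auto simp: equilibrium_plan_def tight_def intro: mult_left_mono)
  qed
  also have "\<dots> = c" using equilibrium_plan_mass[OF Q] by (simp flip: sum_distrib_right)
  finally show ?thesis .
qed

lemma mean_logit_ge:
  assumes Q: "equilibrium_plan Q" and c: "\<And>i j. (i, j) \<in> E \<Longrightarrow> c \<le> U i j"
  shows "c \<le> mean_logit Q U"
proof -
  have "mean_logit Q (\<lambda>i j. - U i j) \<le> - c" using c by (intro mean_logit_le[OF Q]) auto
  then show ?thesis by (simp add: mean_logit_def sum_negf)
qed

text \<open>No logit exceeds \<open>c\<close>; a lower bound on a \<open>Q\<close>-average therefore bounds from below each logit that
  \<open>Q\<close> charges. As \<open>mean_logit Q\<close> increases along the orbit, this confines the tight logits for all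
  times at once.\<close>

lemma logit_lower:
  assumes Q: "equilibrium_plan Q" and U: "\<And>i j. (i, j) \<in> E \<Longrightarrow> U i j \<le> c" and "0 \<le> c"
    and l: "- l \<le> mean_logit Q U" and Qij: "0 < p" "p \<le> Q i j"
  shows "- ((l + c) / p) \<le> U i j"
proof -
  have nonneg: "0 \<le> Q i j * (c - U i j)" for i j
    using Q U by (cases "(i, j) \<in> tight") (auto simp: equilibrium_plan_def tight_def)
  have ij: "(i, j) \<in> E" using Q Qij by (cases "(i, j) \<in> tight") (auto simp: equilibrium_plan_def tight_def)
  have "p * (c - U i j) \<le> Q i j * (c - U i j)" using Qij U[OF ij] by (intro mult_right_mono) auto
  also have "\<dots> \<le> (\<Sum>i\<in>UNIV. \<Sum>j\<in>UNIV. Q i j * (c - U i j))"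
    by (rule term_le_double_sum) (rule nonneg)
  also have "\<dots> = c - mean_logit Q U" using equilibrium_plan_mass[OF Q]
    by (simp add: mean_logit_def right_diff_distrib sum_subtractf flip: sum_distrib_right)
  also have "\<dots> \<le> l + c" using l by simp
  finally have "c - U i j \<le> (l + c) / p" using \<open>0 < p\<close> by (simp add: field_simps)
  then show ?thesis using \<open>0 \<le> c\<close> by simp
qed

text \<open>Every increment of a logit is its drift plus a row error and a column error. By
  \<open>excess_tangent\<close> the errors add up to at most \<open>2 \<eta>\<close> per sweep plus a multiple of the dissipated
  entropy, and the latter is controlled by the ascent of \<open>mean_logit Q\<close>. On an edge that is not tight,
  a small \<open>\<eta>\<close> makes the logit decrease linearly.\<close>

lemma logit_drift:
  assumes Q: "equilibrium_plan Q" and U: "row_normalised U" and "0 < \<eta>"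
    and \<kappa>: "0 < \<kappa>" "\<And>i. \<kappa> \<le> \<mu> i" "\<And>j. \<kappa> \<le> nu_eq j"
  shows "(sweep ^^ t) U i j \<le> U i j + real t * (v i + w j + 2 * \<eta>)
    + (mean_logit Q ((sweep ^^ t) U) - mean_logit Q U) / (\<kappa> * (1 - exp (- \<eta>)))"
proof (induction t)
  case 0
  show ?case by simp
next
  case (Suc t)
  let ?V = "(sweep ^^ t) U" and ?h = "1 - exp (- \<eta>)"
  have h: "0 < ?h" using \<open>0 < \<eta>\<close> by simp
  have "\<kappa> * excess (row_dev ?V i) \<le> \<mu> i * excess (row_dev ?V i)"
    using \<kappa> by (intro mult_right_mono excess_nonneg)
  also have "\<dots> \<le> (\<Sum>i\<in>UNIV. \<mu> i * excess (row_dev ?V i))"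
    by (rule member_le_sum) (auto simp: less_imp_le[OF mu_pos] excess_nonneg)
  finally have 1: "\<kappa> * excess (row_dev ?V i) \<le> (\<Sum>i\<in>UNIV. \<mu> i * excess (row_dev ?V i))" .
  have "\<kappa> * excess (col_dev ?V j) \<le> nu_eq j * excess (col_dev ?V j)"
    using \<kappa> by (intro mult_right_mono excess_nonneg)
  also have "\<dots> \<le> (\<Sum>j\<in>UNIV. nu_eq j * excess (col_dev ?V j))"
    by (rule member_le_sum) (auto simp: less_imp_le[OF nu_eq_pos] excess_nonneg)
  finally have 2: "\<kappa> * excess (col_dev ?V j) \<le> (\<Sum>j\<in>UNIV. nu_eq j * excess (col_dev ?V j))" .
  have "\<kappa> * (excess (row_dev ?V i) + excess (col_dev ?V j)) \<le> mean_logit Q (sweep ?V) - mean_logit Q ?V"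
    using 1 2 mean_logit_sweep[OF Q row_normalised_orbit[OF U, of t]] by (simp add: distrib_left)
  then have "excess (row_dev ?V i) + excess (col_dev ?V j) \<le> (mean_logit Q (sweep ?V) - mean_logit Q ?V) / \<kappa>"
    using \<kappa>(1) by (simp add: field_simps)
  then have "(excess (row_dev ?V i) + excess (col_dev ?V j)) / ?h \<le> (mean_logit Q (sweep ?V) - mean_logit Q ?V) / \<kappa> / ?h"
    using h by (intro divide_right_mono) auto
  moreover have "row_dev ?V i + col_dev ?V j \<le> 2 * \<eta> + (excess (row_dev ?V i) + excess (col_dev ?V j)) / ?h"
    using excess_tangent[OF \<open>0 < \<eta>\<close>, of "row_dev ?V i"] excess_tangent[OF \<open>0 < \<eta>\<close>, of "col_dev ?V j"]
    by (simp add: add_divide_distrib)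
  ultimately have "row_dev ?V i + col_dev ?V j \<le> 2 * \<eta> + (mean_logit Q (sweep ?V) - mean_logit Q ?V) / (\<kappa> * ?h)"
    by simp
  moreover have "(mean_logit Q (sweep ?V) - mean_logit Q U) / (\<kappa> * ?h) =
    (mean_logit Q (sweep ?V) - mean_logit Q ?V) / (\<kappa> * ?h) + (mean_logit Q ?V - mean_logit Q U) / (\<kappa> * ?h)"
    by (simp add: diff_divide_distrib)
  moreover have "real (Suc t) * (v i + w j + 2 * \<eta>) = real t * (v i + w j + 2 * \<eta>) + (v i + w j + 2 * \<eta>)"
    by (simp add: algebra_simps)
  moreover have "(sweep ^^ Suc t) U i j = ?V i j + ((v i + w j) + (row_dev ?V i + col_dev ?V j))"
    using sweep_eq[of ?V i j] by simp
  ultimately have "(sweep ^^ Suc t) U i j \<le> U i j + real (Suc t) * (v i + w j + 2 * \<eta>)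
    + (mean_logit Q (sweep ?V) - mean_logit Q U) / (\<kappa> * ?h)"
    using Suc.IH by linarith
  then show ?case by simp
qed

end

section \<open>The gap is controlled by the dissipation\<close>

context equilibrium
begin

text \<open>The mass that the current plan still puts on edges that are not tight, and that no equilibrium
  plan charges. It measures how far the iteration is from one on the tight subgraph alone.\<close>

definition leak :: "('m \<Rightarrow> 'n \<Rightarrow> real) \<Rightarrow> real" where
  "leak U = (\<Sum>i\<in>UNIV. \<Sum>j\<in>UNIV. if (i, j) \<in> tight then 0 else plan U i j)"

lemma leak_nonneg: "0 \<le> leak U"
  unfolding leak_def by (intro sum_nonneg) (auto simp: plan_nonneg)

lemma leak_le_1: "row_normalised U \<Longrightarrow> leak U \<le> 1"
  unfolding leak_def by (subst total_mass[symmetric, of U]) (auto intro!: sum_mono simp: plan_nonneg)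

text \<open>A Pinsker-type inequality: the column marginal error is controlled by the entropy dissipated in
  the column step.\<close>

lemma col_sum_deviation:
  assumes Q: "equilibrium_plan Q" and U: "row_normalised U"
  shows "(\<Sum>j\<in>UNIV. \<bar>nu_eq j - (\<Sum>i\<in>UNIV. plan U i j)\<bar>)\<^sup>2
    \<le> 4 * real CARD('n) * (\<Sum>j\<in>UNIV. nu_eq j * excess (col_dev U j))"
proof -
  have "\<bar>nu_eq j - (\<Sum>i\<in>UNIV. plan U i j)\<bar>\<^sup>2 \<le> 4 * (nu_eq j * excess (col_dev U j))" for j
  proof -
    have n1: "nu_eq j \<le> 1"
      unfolding sum_nu_eq[OF Q, symmetric] by (rule member_le_sum) (auto simp: less_imp_le[OF nu_eq_pos])
    have "(\<Sum>i\<in>UNIV. plan U i j) \<le> (\<Sum>j\<in>UNIV. \<Sum>i\<in>UNIV. plan U i j)"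
      by (rule member_le_sum[of j UNIV "\<lambda>j. \<Sum>i\<in>UNIV. plan U i j"]) (auto intro: sum_nonneg plan_nonneg)
    also have "\<dots> = 1" using total_mass[OF U] by (subst sum.swap)
    finally have "nu_eq j * exp (- col_dev U j) \<le> 1" by (simp add: exp_col_dev)
    then have "exp (- col_dev U j) \<le> 1 / nu_eq j" using nu_eq_pos[of j] by (simp add: field_simps)
    from excess_ge_deviation[OF this]
    have "(nu_eq j)\<^sup>2 * (exp (- col_dev U j) - 1)\<^sup>2 \<le> (nu_eq j)\<^sup>2 * (2 * (1 + 1 / nu_eq j) * excess (col_dev U j))"
      by (intro mult_left_mono) auto
    also have "\<dots> = 2 * (nu_eq j + 1) * (nu_eq j * excess (col_dev U j))"
      using nu_eq_pos[of j] by (simp add: field_simps power2_eq_square)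
    also have "\<dots> \<le> 4 * (nu_eq j * excess (col_dev U j))"
      using n1 nu_eq_pos[of j] excess_nonneg[of "col_dev U j"] by (intro mult_right_mono) auto
    also have "(nu_eq j)\<^sup>2 * (exp (- col_dev U j) - 1)\<^sup>2 = \<bar>nu_eq j - nu_eq j * exp (- col_dev U j)\<bar>\<^sup>2"
      by (simp add: power2_eq_square algebra_simps)
    finally show ?thesis by (simp add: exp_col_dev)
  qed
  then have "(\<Sum>j\<in>UNIV. \<bar>nu_eq j - (\<Sum>i\<in>UNIV. plan U i j)\<bar>\<^sup>2)
      \<le> (\<Sum>j\<in>UNIV. 4 * (nu_eq j * excess (col_dev U j)))" by (rule sum_mono)
  then have "(\<Sum>j\<in>UNIV. \<bar>nu_eq j - (\<Sum>i\<in>UNIV. plan U i j)\<bar>\<^sup>2) * real CARD('n)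
      \<le> (4 * (\<Sum>j\<in>UNIV. nu_eq j * excess (col_dev U j))) * real CARD('n)"
    by (intro mult_right_mono) (auto simp: sum_distrib_left)
  from order_trans[OF sum_squared_le_sum_of_squares this] show ?thesis by (simp only: mult_ac)
qed

lemma plan_exp_quadratic:
  assumes "(i, j) \<in> E" and V: "V i j = U i j + d" and p: "p \<le> plan U i j" "p \<le> plan V i j"
  shows "plan U i j * d \<le> plan V i j - plan U i j - p / 2 * d\<^sup>2"
proof -
  have PV: "plan V i j = plan U i j * exp d"
    using assms by (simp add: plan_def exp_add)
  have "p \<le> plan U i j * min 1 (exp d)" using p plan_nonneg[of U i j]
    by (simp add: PV min_def)
  then have "p / 2 * d\<^sup>2 \<le> plan U i j * min 1 (exp d) / 2 * d\<^sup>2"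
    by (intro mult_right_mono) auto
  moreover have "plan U i j * (1 + d + d\<^sup>2 / 2 * min 1 (exp d)) \<le> plan U i j * exp d"
    by (intro mult_left_mono exp_ge_quadratic plan_nonneg)
  ultimately show ?thesis by (simp add: PV algebra_simps)
qed

text \<open>A Polyak-Lojasiewicz inequality. The dual objective is concave in the logits, and strongly concave
  on the tight edges as long as the plan entries there stay above \<open>p\<close>. Its gradient consists of
  marginal errors, which the entropy dissipation controls up to the leak. So what can still be gained
  at a row-normalised state that differs only by potentials is at most a multiple of the entropy
  dissipated in the next column step, plus a multiple of the leak. The potentials that separate the
  two states have to be taken in the gauge of \<open>bounded_potentials\<close>, because only the logits on tight edges enter the quadratic term.\<close>

lemma ascent_bounds_gap:
  assumes Q: "equilibrium_plan Q" and U: "row_normalised U" and V: "row_normalised V"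
    and VU: "\<And>i j. V i j = U i j + (a i + b j)"
    and p: "0 < p" "\<And>i j. (i, j) \<in> tight \<Longrightarrow> p \<le> plan U i j" "\<And>i j. (i, j) \<in> tight \<Longrightarrow> p \<le> plan V i j"
    and \<Gamma>: "0 < \<Gamma>"
      "\<And>a b D. (\<And>i j. (i, j) \<in> tight \<Longrightarrow> \<bar>a i + b j\<bar> \<le> D) \<Longrightarrow> 0 \<le> D \<Longrightarrow>
      \<exists>a' b'. (\<forall>i j. (i, j) \<in> tight \<longrightarrow> a' i + b' j = a i + b j) \<and>
        (\<forall>i. \<bar>a' i\<bar> \<le> \<Gamma> * D) \<and> (\<forall>j. \<bar>b' j\<bar> \<le> \<Gamma> * D)"
  shows "mean_logit Q V - mean_logit Q U
    \<le> (1 + 4 * \<Gamma>\<^sup>2 * real CARD('n) / p) * ((\<Sum>j\<in>UNIV. nu_eq j * excess (col_dev U j)) + leak U)"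
proof -
  define D where "D = sqrt (\<Sum>i\<in>UNIV. \<Sum>j\<in>UNIV. if (i, j) \<in> tight then (a i + b j)\<^sup>2 else 0)"
  have D2: "D\<^sup>2 = (\<Sum>i\<in>UNIV. \<Sum>j\<in>UNIV. if (i, j) \<in> tight then (a i + b j)\<^sup>2 else 0)"
    unfolding D_def by (intro real_sqrt_pow2 sum_nonneg) auto
  have D0: "0 \<le> D" unfolding D_def by (intro real_sqrt_ge_zero sum_nonneg) auto
  have Dge: "\<bar>a i + b j\<bar> \<le> D" if "(i, j) \<in> tight" for i j
  proof -
    have "(a i + b j)\<^sup>2 \<le> D\<^sup>2"
      using term_le_double_sum[of "\<lambda>i j. if (i, j) \<in> tight then (a i + b j)\<^sup>2 else 0" i j] that
      by (simp add: D2)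
    then show ?thesis using D0 abs_le_square_iff[of "a i + b j" D] by simp
  qed
  obtain a' b' where ab': "\<And>i j. (i, j) \<in> tight \<Longrightarrow> a' i + b' j = a i + b j"
    "\<And>i. \<bar>a' i\<bar> \<le> \<Gamma> * D" "\<And>j. \<bar>b' j\<bar> \<le> \<Gamma> * D"
    using \<Gamma>(2)[of a b D] Dge D0 by blast
  define O' where "O' i j = (if (i, j) \<in> tight then 0 else plan U i j)" for i j
  define TV where "TV i j = (if (i, j) \<in> tight then plan V i j else 0)" for i j
  define e where "e = (\<Sum>j\<in>UNIV. \<bar>nu_eq j - (\<Sum>i\<in>UNIV. plan U i j)\<bar>)"
  define N where "N = real CARD('n)"
  have N1: "1 \<le> N" unfolding N_def using zero_less_card_finite[where 'a = 'n] by linarith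
  have "mean_logit Q V - mean_logit Q U = (\<Sum>i\<in>UNIV. \<Sum>j\<in>UNIV. Q i j * (a i + b j))"
    by (simp add: mean_logit_def VU distrib_left sum.distrib)
  also have "\<dots> \<le> (\<Sum>i\<in>UNIV. \<Sum>j\<in>UNIV. (Q i j - plan U i j) * (a' i + b' j) + O' i j * (a' i + b' j)
      + (TV i j - (plan U i j - O' i j)) - p / 2 * (if (i, j) \<in> tight then (a i + b j)\<^sup>2 else 0))"
  proof (intro sum_mono)
    fix i j
    show "Q i j * (a i + b j) \<le> (Q i j - plan U i j) * (a' i + b' j) + O' i j * (a' i + b' j)
      + (TV i j - (plan U i j - O' i j)) - p / 2 * (if (i, j) \<in> tight then (a i + b j)\<^sup>2 else 0)"
    proof (cases "(i, j) \<in> tight")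
      case True
      then have "(i, j) \<in> E" by (simp add: tight_def)
      from plan_exp_quadratic[of i j V U "a i + b j" p, OF this VU p(2)[OF True] p(3)[OF True]]
      show ?thesis using True by (simp add: ab' O'_def TV_def left_diff_distrib)
    next
      case False
      then have "Q i j = 0" using Q by (simp add: equilibrium_plan_def)
      then show ?thesis using False by (simp add: O'_def TV_def left_diff_distrib)
    qed
  qed
  also have "\<dots> = (\<Sum>i\<in>UNIV. \<Sum>j\<in>UNIV. (Q i j - plan U i j) * (a' i + b' j))
      + (\<Sum>i\<in>UNIV. \<Sum>j\<in>UNIV. O' i j * (a' i + b' j))
      + ((\<Sum>i\<in>UNIV. \<Sum>j\<in>UNIV. TV i j) - (1 - leak U)) - p / 2 * D\<^sup>2"
    unfolding D2 sum_distrib_left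
    by (simp add: sum.distrib sum_subtractf total_mass[OF U] leak_def flip: O'_def)
  also have "(\<Sum>i\<in>UNIV. \<Sum>j\<in>UNIV. (Q i j - plan U i j) * (a' i + b' j))
      = (\<Sum>j\<in>UNIV. (nu_eq j - (\<Sum>i\<in>UNIV. plan U i j)) * b' j)"
    unfolding sum_pairing using Q U by (simp add: sum_subtractf equilibrium_plan_def row_normalised_def)
  also have "\<dots> \<le> (\<Sum>j\<in>UNIV. \<bar>nu_eq j - (\<Sum>i\<in>UNIV. plan U i j)\<bar> * (\<Gamma> * D))"
  proof (rule sum_mono)
    fix j
    have "(nu_eq j - (\<Sum>i\<in>UNIV. plan U i j)) * b' j \<le> \<bar>nu_eq j - (\<Sum>i\<in>UNIV. plan U i j)\<bar> * \<bar>b' j\<bar>"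
      by (simp flip: abs_mult)
    also have "\<dots> \<le> \<bar>nu_eq j - (\<Sum>i\<in>UNIV. plan U i j)\<bar> * (\<Gamma> * D)"
      by (intro mult_left_mono ab') auto
    finally show "(nu_eq j - (\<Sum>i\<in>UNIV. plan U i j)) * b' j \<le> \<bar>nu_eq j - (\<Sum>i\<in>UNIV. plan U i j)\<bar> * (\<Gamma> * D)" .
  qed
  also have "\<dots> = \<Gamma> * D * e" by (simp add: e_def flip: sum_distrib_right)
  also have "(\<Sum>i\<in>UNIV. \<Sum>j\<in>UNIV. O' i j * (a' i + b' j)) \<le> (\<Sum>i\<in>UNIV. \<Sum>j\<in>UNIV. O' i j * (2 * \<Gamma> * D))"
  proof (intro sum_mono mult_left_mono)
    fix i j show "a' i + b' j \<le> 2 * \<Gamma> * D" using ab'(2)[of i] ab'(3)[of j] by linarith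
  qed (auto simp: O'_def plan_nonneg)
  also have "\<dots> = \<Gamma> * D * (2 * leak U)"
    by (simp add: leak_def flip: O'_def sum_distrib_right)
  also have "(\<Sum>i\<in>UNIV. \<Sum>j\<in>UNIV. TV i j) \<le> 1"
    unfolding total_mass[OF V, symmetric] by (intro sum_mono) (simp add: TV_def plan_nonneg)
  finally have main: "mean_logit Q V - mean_logit Q U \<le> \<Gamma> * D * e + \<Gamma> * D * (2 * leak U)
      + (1 - (1 - leak U)) - p / 2 * D\<^sup>2" by simp
  define x where "x = (\<Sum>j\<in>UNIV. nu_eq j * excess (col_dev U j))"
  have x0: "0 \<le> x" unfolding x_def by (rule excess_sums_nonneg)
  have e2: "e\<^sup>2 \<le> 4 * N * x" unfolding e_def N_def x_def by (rule col_sum_deviation[OF Q U])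
  have l2: "(leak U)\<^sup>2 \<le> N * leak U"
  proof -
    have "(leak U)\<^sup>2 \<le> 1 * leak U" using leak_nonneg[of U] leak_le_1[OF U]
      unfolding power2_eq_square by (intro mult_right_mono) auto
    also have "\<dots> \<le> N * leak U" using N1 leak_nonneg[of U] by (intro mult_right_mono) auto
    finally show ?thesis .
  qed
  have "(e + 2 * leak U)\<^sup>2 \<le> 2 * e\<^sup>2 + 8 * (leak U)\<^sup>2"
    using zero_le_power2[of "e - 2 * leak U"] by (simp add: power2_eq_square algebra_simps)
  also have "\<dots> \<le> 8 * N * (x + leak U)" using e2 l2 by (simp add: algebra_simps)
  finally have sq: "(e + 2 * leak U)\<^sup>2 \<le> 8 * N * (x + leak U)" .
  have "mean_logit Q V - mean_logit Q U \<le> leak U + (\<Gamma> * D * (e + 2 * leak U) - p / 2 * D\<^sup>2)"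
    using main by (simp add: distrib_left)
  also have "\<dots> \<le> leak U + \<Gamma>\<^sup>2 * (e + 2 * leak U)\<^sup>2 / (2 * p)"
    using linear_minus_quadratic_le[OF p(1)] by (intro add_left_mono)
  also have "\<dots> \<le> leak U + \<Gamma>\<^sup>2 * (8 * N * (x + leak U)) / (2 * p)"
    using sq p(1) by (intro add_left_mono divide_right_mono mult_left_mono) auto
  also have "\<dots> \<le> (x + leak U) + \<Gamma>\<^sup>2 * (8 * N * (x + leak U)) / (2 * p)"
    using x0 by simp
  also have "\<dots> = (1 + 4 * \<Gamma>\<^sup>2 * N / p) * (x + leak U)"
    using p(1) by (simp add: field_simps)
  finally show ?thesis by (simp add: x_def N_def)
qed

end

section \<open>Linear convergence of the increments\<close>

text \<open>The gap to the limit contracts by a factor \<open>1 - exp (- R (1 + \<delta>))\<close> in each sweep, up to the leak. The leak is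
  only known to be small after a time \<open>t0\<close> proportional to \<open>1 + \<delta>\<close>. Until then the monotonicity of the
  gap suffices, because a contraction factor so close to \<open>1\<close> loses at most a factor \<open>2\<close> up to the
  time \<open>t0\<close>. Afterwards \<open>gap + H * exp (- \<sigma> n)\<close> is a Lyapunov function.\<close>

lemma perturbed_contraction_decay:
  fixes C R \<sigma> G :: real
  assumes "0 < R" "0 < C" "0 < G" "0 < \<sigma>"
  shows "\<exists>B R'. 0 < B \<and> 0 < R' \<and> (\<forall>\<delta> gap leak. 0 \<le> \<delta> \<longrightarrow> (\<forall>t. 0 \<le> gap t) \<longrightarrow> decseq gap \<longrightarrow>
     gap 0 \<le> G * (1 + \<delta>) \<longrightarrow> (\<forall>t. leak t \<le> exp (C * (1 + \<delta>) - \<sigma> * real t)) \<longrightarrow>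
     (\<forall>t. gap t \<le> exp (R * (1 + \<delta>)) * (gap t - gap (Suc t) + leak t)) \<longrightarrow>
     (\<forall>t. gap t \<le> B * (1 + \<delta>) * (1 - exp (- (R' * (1 + \<delta>)))) ^ t))"
proof -
  define h where "h = 1 - exp (- \<sigma>)"
  have h: "0 < h" "h < 1" using \<open>0 < \<sigma>\<close> by (auto simp: h_def)
  define H where "H = 2 / h"
  have H: "0 < H" using h by (simp add: H_def)
  define K where "K = C / \<sigma> + 1"
  have K: "1 < K" using assms by (simp add: K_def)
  \<comment> \<open>The summands ensure in turn \<open>\<theta> \<le> exp (- R (1 + \<delta>))\<close>, \<open>\<theta> t0 \<le> 1 / 2\<close> and \<open>\<theta> \<le> h / 2\<close>.\<close>
  define R' where "R' = R + 2 * K + 2 / h"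
  define B where "B = 2 * (G + H)"
  have R': "0 < R'" using assms K h by (simp add: R'_def add_pos_pos)
  have B: "0 < B" using assms H by (simp add: B_def)
  have main: "gap t \<le> B * (1 + \<delta>) * (1 - exp (- (R' * (1 + \<delta>)))) ^ t"
    if \<delta>: "0 \<le> \<delta>" and g0: "\<forall>t. 0 \<le> gap t" and dec: "decseq gap"
      and gG: "gap 0 \<le> G * (1 + \<delta>)" and leak: "\<forall>t. leak t \<le> exp (C * (1 + \<delta>) - \<sigma> * real t)"
      and rec: "\<forall>t. gap t \<le> exp (R * (1 + \<delta>)) * (gap t - gap (Suc t) + leak t)"
    for \<delta> :: real and gap leak :: "nat \<Rightarrow> real" and t
  proof -
    define \<theta> where "\<theta> = exp (- (R' * (1 + \<delta>)))"
    have \<theta>pos: "0 < \<theta>" by (simp add: \<theta>_def)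
    have inv_bound: "\<theta> * z \<le> 1" if "z \<le> R' * (1 + \<delta>)" for z
    proof -
      have "z \<le> exp (R' * (1 + \<delta>))" using exp_ge_add_one_self[of "R' * (1 + \<delta>)"] that by linarith
      then have "\<theta> * z \<le> \<theta> * exp (R' * (1 + \<delta>))" using \<theta>pos by (intro mult_left_mono) auto
      then show ?thesis by (simp add: \<theta>_def flip: exp_add)
    qed
    have \<theta>h: "\<theta> \<le> h / 2"
    proof -
      have "2 / h * 1 \<le> R' * (1 + \<delta>)" unfolding R'_def using \<delta> assms K h
        by (intro mult_mono) auto
      from inv_bound[of "2 / h"] this show ?thesis using h by (simp add: field_simps)
    qed
    have \<theta>K: "\<theta> * (2 * K * (1 + \<delta>)) \<le> 1"
      by (rule inv_bound) (use \<delta> assms K h in \<open>auto simp: R'_def intro!: mult_right_mono\<close>)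
    have \<theta>R: "\<theta> * exp (R * (1 + \<delta>)) \<le> 1"
    proof -
      have "R * (1 + \<delta>) \<le> R' * (1 + \<delta>)"
        using \<delta> K h by (intro mult_right_mono) (auto simp: R'_def)
      then show ?thesis by (simp add: \<theta>_def flip: exp_add)
    qed
    have rec': "gap (Suc s) \<le> (1 - \<theta>) * gap s + leak s" for s
    proof -
      have "\<theta> * gap s \<le> \<theta> * (exp (R * (1 + \<delta>)) * (gap s - gap (Suc s) + leak s))"
        using rec \<theta>pos by (intro mult_left_mono) auto
      also have "\<dots> = (\<theta> * exp (R * (1 + \<delta>))) * (gap s - gap (Suc s) + leak s)" by simp
      also have "\<dots> \<le> 1 * (gap s - gap (Suc s) + leak s)"
      proof (intro mult_right_mono \<theta>R)
        have "0 \<le> exp (R * (1 + \<delta>)) * (gap s - gap (Suc s) + leak s)"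
          using rec g0 order_trans by blast
        then show "0 \<le> gap s - gap (Suc s) + leak s" by (simp add: zero_le_mult_iff)
      qed
      finally show ?thesis by (simp add: algebra_simps)
    qed
    define t0 where "t0 = nat \<lceil>C * (1 + \<delta>) / \<sigma>\<rceil>"
    have t0_ge: "C * (1 + \<delta>) / \<sigma> \<le> real t0" unfolding t0_def by linarith
    have t0_le: "real t0 \<le> K * (1 + \<delta>)"
    proof -
      have "0 \<le> C * (1 + \<delta>) / \<sigma>" using assms \<delta> by simp
      then have "real t0 \<le> C * (1 + \<delta>) / \<sigma> + 1" unfolding t0_def by linarith
      also have "\<dots> \<le> K * (1 + \<delta>)" using \<delta> by (simp add: K_def algebra_simps)
      finally show ?thesis .
    qed
    have leak': "leak (t0 + n) \<le> exp (- \<sigma> * real n)" for n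
    proof -
      have "C * (1 + \<delta>) \<le> \<sigma> * real t0" using t0_ge \<open>0 < \<sigma>\<close> by (simp add: field_simps)
      then have "exp (C * (1 + \<delta>) - \<sigma> * real (t0 + n)) \<le> exp (- \<sigma> * real n)"
        by (simp add: algebra_simps)
      with leak show ?thesis using order_trans by blast
    qed
    have q: "0 \<le> 1 - \<theta>" "1 - \<theta> \<le> 1" using \<theta>h h \<theta>pos by auto
    have lyap: "gap (t0 + n) + H * exp (- \<sigma> * real n) \<le> (1 - \<theta>) ^ n * (gap t0 + H)" for n
    proof (induction n)
      case 0 then show ?case by simp
    next
      case (Suc n)
      let ?x = "exp (- \<sigma> * real n)"
      have "H * exp (- \<sigma> * real (Suc n)) = ?x * (H * (1 - h))"
        by (simp add: h_def algebra_simps flip: exp_add)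
      moreover have "?x * (1 + H * (1 - h)) \<le> ?x * ((1 - \<theta>) * H)" (is "?l \<le> _")
      proof (rule mult_left_mono)
        have "\<theta> * H \<le> h / 2 * H" using \<theta>h H by (intro mult_right_mono) auto
        then show "1 + H * (1 - h) \<le> (1 - \<theta>) * H" using h by (simp add: H_def field_simps)
      qed simp
      moreover have "?l = ?x + ?x * (H * (1 - h))" by (simp only: distrib_left mult_1_right)
      ultimately have "gap (t0 + Suc n) + H * exp (- \<sigma> * real (Suc n)) \<le> (1 - \<theta>) * gap (t0 + n) + ?x * ((1 - \<theta>) * H)"
        using rec'[of "t0 + n", folded add_Suc_right] leak'[of n] by linarith
      also have "\<dots> = (1 - \<theta>) * (gap (t0 + n) + H * ?x)" by (simp add: algebra_simps)
      also have "\<dots> \<le> (1 - \<theta>) * ((1 - \<theta>) ^ n * (gap t0 + H))"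
        using Suc.IH q by (intro mult_left_mono) auto
      finally show ?case by simp
    qed
    have gt0: "gap s \<le> G * (1 + \<delta>)" for s using decseqD[OF dec, of 0 s] gG by simp
    have half: "1 \<le> 2 * (1 - \<theta>) ^ s" if "s \<le> t0" for s
    proof -
      have "real s * \<theta> \<le> K * (1 + \<delta>) * \<theta>" using that t0_le \<theta>pos by (intro mult_right_mono) auto
      also have "\<dots> \<le> 1 / 2" using \<theta>K by (simp add: mult_ac)
      finally have "1 / 2 \<le> 1 + real s * (- \<theta>)" by simp
      also have "\<dots> \<le> (1 + (- \<theta>)) ^ s" using q by (intro Bernoulli_inequality) auto
      finally show ?thesis by simp
    qed
    have GH: "G * (1 + \<delta>) + H \<le> (G + H) * (1 + \<delta>)" using H \<delta> by (simp add: algebra_simps)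
    have pos: "0 \<le> (G + H) * (1 + \<delta>)" using assms H \<delta> by auto
    show ?thesis
    proof (cases "t \<le> t0")
      case True
      have "gap t \<le> (G + H) * (1 + \<delta>) * 1" using gt0[of t] GH H by linarith
      also have "\<dots> \<le> (G + H) * (1 + \<delta>) * (2 * (1 - \<theta>) ^ t)"
        using half[OF True] pos by (intro mult_left_mono) auto
      finally show ?thesis unfolding B_def \<theta>_def by (simp only: mult_ac)
    next
      case False
      then obtain n where t: "t = t0 + n" using le_Suc_ex[of t0 t] by auto
      have "gap t \<le> (1 - \<theta>) ^ n * (gap t0 + H)"
        using lyap[of n] H by (simp add: t) (smt (verit) exp_gt_zero mult_pos_pos)
      also have "\<dots> \<le> (1 - \<theta>) ^ n * ((G + H) * (1 + \<delta>))"
        using gt0[of t0] GH q by (intro mult_left_mono) auto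
      also have "\<dots> \<le> (1 - \<theta>) ^ n * ((G + H) * (1 + \<delta>)) * (2 * (1 - \<theta>) ^ t0)"
        using half[of t0] pos q by (subst mult_le_cancel_left1) (auto simp: mult_less_0_iff not_less zero_le_mult_iff)
      also have "\<dots> = (1 - \<theta>) ^ t * (2 * ((G + H) * (1 + \<delta>)))" by (simp add: t power_add mult_ac)
      finally show ?thesis unfolding B_def \<theta>_def by (simp only: mult_ac)
    qed
  qed
  show ?thesis using main R' B by blast
qed

lemma finite_pos_lower_bound:
  fixes f :: "'a \<Rightarrow> real"
  assumes "finite A" and "\<And>x. x \<in> A \<Longrightarrow> 0 < f x"
  obtains k where "0 < k" "\<And>x. x \<in> A \<Longrightarrow> k \<le> f x"
proof (rule that[of "Min (insert 1 (f ` A))"])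
  show "0 < Min (insert 1 (f ` A))" using assms by (subst Min_gr_iff) auto
  show "Min (insert 1 (f ` A)) \<le> f x" if "x \<in> A" for x using assms that by (intro Min_le) auto
qed

text \<open>Converts the rate per sweep for the gap into a rate per iteration for the increments: the square
  root comes from \<open>abs_le_of_excess_le\<close>, and \<open>2 * t + 4\<close> is the last iteration at which a row increment
  of sweep \<open>t\<close> is visible.\<close>

lemma half_rate_power:
  fixes \<theta> q :: real
  assumes "0 < \<theta>" "\<theta> \<le> 1" "1 - \<theta> / 8 \<le> q" "q \<le> 1"
  shows "sqrt (1 - \<theta>) ^ t \<le> 16 * q ^ (2 * t + 4)"
proof -
  have "(1 - \<theta> / 8) ^ 2 \<le> q ^ 2" using assms by (intro power_mono) auto
  moreover have "(1 - \<theta> / 8)\<^sup>2 = 1 - \<theta> / 4 + \<theta>\<^sup>2 / 64" by (simp add: power2_eq_square algebra_simps)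
  ultimately have q2: "1 - \<theta> / 4 \<le> q\<^sup>2" using zero_le_power2[of \<theta>] by linarith
  have "sqrt (1 - \<theta>) \<le> 1 - \<theta> / 2"
    using assms by (intro real_le_lsqrt) (auto simp: power2_eq_square algebra_simps)
  also have "\<dots> \<le> q\<^sup>2" using q2 assms by simp
  finally have 1: "sqrt (1 - \<theta>) ^ t \<le> q ^ (2 * t)"
    unfolding power_mult by (intro power_mono) (use assms in auto)
  have "(1 / 2) ^ 4 \<le> q ^ 4" using assms by (intro power_mono) auto
  then have "q ^ (2 * t) * 1 \<le> q ^ (2 * t) * (16 * q ^ 4)"
    using assms by (intro mult_left_mono) (auto simp: power4_eq_xxxx)
  with 1 show ?thesis by (simp add: power_add mult_ac)
qed

context equilibrium
begin

text \<open>The gap inequality needs a plan that charges every tight edge: this is where the equality of the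
  two index sets enters. The drift bound makes the leak small, the lower bound on the tight logits gives
  the constant \<open>exp (- R (1 + \<delta>))\<close>, and the error of each increment is then bounded through its excess by
  the gap.\<close>

lemma linear_convergence:
  assumes Q: "equilibrium_plan Q" and full: "\<And>i j. (i, j) \<in> tight \<Longrightarrow> 0 < Q i j"
  shows "\<exists>B R. 0 < B \<and> 0 < R \<and> (\<forall>\<delta> U t. 0 \<le> \<delta> \<longrightarrow> (\<forall>i j. (i, j) \<in> E \<longrightarrow> \<bar>U i j\<bar> \<le> \<delta>) \<longrightarrow>
    (\<forall>j. \<bar>col_dev ((sweep ^^ t) (row_step U)) j\<bar> \<le> B * (1 + \<delta>) * (1 - exp (- (R * (1 + \<delta>)))) ^ (2 * t + 4)) \<and>
    (\<forall>i. \<bar>row_dev ((sweep ^^ t) (row_step U)) i\<bar> \<le> B * (1 + \<delta>) * (1 - exp (- (R * (1 + \<delta>)))) ^ (2 * t + 4)))"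
proof -
  obtain k1 where k1: "0 < k1" "\<And>i. k1 \<le> \<mu> i"
    using finite_pos_lower_bound[of UNIV \<mu>] mu_pos by auto
  obtain k2 where k2: "0 < k2" "\<And>j. k2 \<le> nu_eq j"
    using finite_pos_lower_bound[of UNIV nu_eq] nu_eq_pos by auto
  define \<kappa> where "\<kappa> = min k1 k2"
  have \<kappa>: "0 < \<kappa>" "\<And>i. \<kappa> \<le> \<mu> i" "\<And>j. \<kappa> \<le> nu_eq j"
    using k1 k2 by (auto simp: \<kappa>_def min_le_iff_disj)
  obtain p0 where "0 < p0" "\<And>x. x \<in> tight \<Longrightarrow> p0 \<le> (case x of (i, j) \<Rightarrow> Q i j)"
    using finite_pos_lower_bound[of tight "\<lambda>(i, j). Q i j"] full by auto
  then have p0: "0 < p0" "\<And>i j. (i, j) \<in> tight \<Longrightarrow> p0 \<le> Q i j" by auto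
  have "0 < - (v (fst z) + w (snd z))" if "z \<in> E - tight" for z
    using that drift_nonpos[of "fst z" "snd z"] by (cases z) (auto simp: tight_def)
  then obtain \<rho> where \<rho>: "0 < \<rho>" and "\<And>z. z \<in> E - tight \<Longrightarrow> \<rho> \<le> - (v (fst z) + w (snd z))"
    using finite_pos_lower_bound[of "E - tight" "\<lambda>z. - (v (fst z) + w (snd z))"] by auto
  then have \<rho>_gap: "v i + w j \<le> - \<rho>" if "(i, j) \<in> E" "(i, j) \<notin> tight" for i j
    using that by (metis DiffI fst_conv snd_conv le_minus_iff)
  have "0 < \<mu> (fst z) * \<nu> (snd z)" for z using mu_pos nu_pos by simp
  then obtain m0 where m0: "0 < m0" and "\<And>z. z \<in> UNIV \<Longrightarrow> m0 \<le> \<mu> (fst z) * \<nu> (snd z)"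
    using finite_pos_lower_bound[of UNIV "\<lambda>z. \<mu> (fst z) * \<nu> (snd z)"] by auto
  then have m0_le: "m0 \<le> \<mu> i * \<nu> j" for i j by (metis UNIV_I fst_conv snd_conv)
  obtain \<Gamma> :: real where \<Gamma>: "0 < \<Gamma>"
    "\<And>a b D. (\<And>i j. (i, j) \<in> tight \<Longrightarrow> \<bar>a i + b j\<bar> \<le> D) \<Longrightarrow> 0 \<le> D \<Longrightarrow>
      \<exists>a' b'. (\<forall>i j. (i, j) \<in> tight \<longrightarrow> a' i + b' j = a i + b j) \<and>
        (\<forall>i. \<bar>a' i\<bar> \<le> \<Gamma> * D) \<and> (\<forall>j. \<bar>b' j\<bar> \<le> \<Gamma> * D)"
    using bounded_potentials[of tight] by blast
  \<comment> \<open>A bound for the logits of row-normalised states on \<open>E\<close>, see \<open>logit_upper\<close>.\<close>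
  define c where "c = (\<Sum>j\<in>UNIV. \<bar>ln (\<nu> j)\<bar>)"
  have c0: "0 \<le> c" by (simp add: c_def sum_nonneg)
  have c: "- ln (\<nu> j) \<le> c" for j
    using member_le_sum[of j UNIV "\<lambda>j. \<bar>ln (\<nu> j)\<bar>"] by (simp add: c_def)
  define k where "k = \<kappa> * (1 - exp (- (\<rho> / 4)))"
  have k: "0 < k" using \<kappa> \<rho> by (simp add: k_def)
  define C where "C = c + (c + 2) / k"
  have C: "0 < C" using c0 k by (simp add: C_def add_nonneg_pos)
  define H where "H = 4 * \<Gamma>\<^sup>2 * real CARD('n) / m0"
  have H: "0 < H" using \<Gamma> m0 by (simp add: H_def)
  define R where "R = H + (c + 2) / p0"
  have R: "0 < R" using H c0 p0 by (simp add: R_def add_pos_nonneg)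
  have c2: "0 < c + 2" and \<rho>2: "0 < \<rho> / 2" using c0 \<rho> by auto
  obtain B R' where B: "0 < B" and R': "0 < R'" and
    decay: "\<forall>\<delta> gap leak. 0 \<le> \<delta> \<longrightarrow> (\<forall>t. 0 \<le> gap t) \<longrightarrow> decseq gap \<longrightarrow>
      gap 0 \<le> (c + 2) * (1 + \<delta>) \<longrightarrow> (\<forall>t. leak t \<le> exp (C * (1 + \<delta>) - \<rho> / 2 * real t)) \<longrightarrow>
      (\<forall>t. gap t \<le> exp (R * (1 + \<delta>)) * (gap t - gap (Suc t) + leak t)) \<longrightarrow>
      (\<forall>t. gap t \<le> B * (1 + \<delta>) * (1 - exp (- (R' * (1 + \<delta>)))) ^ t)"
    using perturbed_contraction_decay[OF R C c2 \<rho>2] by (elim exE conjE)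
  \<comment> \<open>\<open>80 = 5 * 16\<close>: the factor \<open>5\<close> comes from \<open>abs_le_of_excess_le\<close>, the factor \<open>16\<close> from \<open>half_rate_power\<close>.\<close>
  define B' where "B' = 80 * (B / \<kappa> + 1)"
  have B': "0 < B'" using B \<kappa> by (simp add: B'_def add_pos_pos)
  have main: "\<bar>col_dev ((sweep ^^ t) (row_step U)) j\<bar> \<le> B' * (1 + \<delta>) * (1 - exp (- ((R' + 3) * (1 + \<delta>)))) ^ (2 * t + 4)
      \<and> \<bar>row_dev ((sweep ^^ t) (row_step U)) i\<bar> \<le> B' * (1 + \<delta>) * (1 - exp (- ((R' + 3) * (1 + \<delta>)))) ^ (2 * t + 4)"
    if \<delta>: "0 \<le> \<delta>" and U\<delta>: "\<forall>i j. (i, j) \<in> E \<longrightarrow> \<bar>U i j\<bar> \<le> \<delta>" for \<delta> U t i j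
  proof -
    define V where "V t = (sweep ^^ t) (row_step U)" for t
    define A where "A t = mean_logit Q (V t)" for t
    have VSuc: "V (Suc t) = sweep (V t)" for t by (simp add: V_def)
    have Vn: "row_normalised (V t)" for t
      unfolding V_def by (intro row_normalised_orbit row_normalised_row_step)
    have Vc: "V t i j \<le> c" if "(i, j) \<in> E" for t i j
      using logit_upper[OF Vn that] c by (rule order_trans)
    have A_mono: "A s \<le> A t" if "s \<le> t" for s t
      unfolding A_def V_def by (rule mean_logit_mono_orbit[OF Q row_normalised_row_step that])
    have A0: "- (2 * \<delta>) \<le> A 0"
      unfolding A_def V_def using U\<delta> by (intro mean_logit_ge[OF Q]) (auto intro: row_step_lower)
    have Ac: "A t \<le> c" for t unfolding A_def using Vc by (intro mean_logit_le[OF Q])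
    obtain L where L: "A \<longlonglongrightarrow> L" "\<And>t. A t \<le> L"
      using incseq_convergent[of A c] A_mono Ac by (auto simp: incseq_def)
    have Lc: "L \<le> c" using L(1) Ac by (intro LIMSEQ_le_const2) auto
    define gap where "gap t = L - A t" for t
    define x where "x t = (\<Sum>j\<in>UNIV. nu_eq j * excess (col_dev (V t) j))" for t
    define y where "y t = (\<Sum>i\<in>UNIV. \<mu> i * excess (row_dev (V t) i))" for t
    have xy: "0 \<le> x t" "0 \<le> y t" for t unfolding x_def y_def by (rule excess_sums_nonneg)+
    have inc: "y t + x t \<le> A (Suc t) - A t" for t
      using mean_logit_sweep[OF Q Vn, of t] by (simp add: A_def VSuc x_def y_def)
    have scale: "z + 2 * \<delta> \<le> (z + 2) * (1 + \<delta>)" if "0 \<le> z" for z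
      using \<delta> that by (simp add: algebra_simps)
    have low: "- ((2 * \<delta> + c) / p0) \<le> V t i j" if "(i, j) \<in> tight" for t i j
      using that A0 A_mono[of 0 t] p0
      by (intro logit_lower[OF Q Vc c0]) (auto simp: A_def)
    define p where "p = exp (- ((2 * \<delta> + c) / p0)) * m0"
    have p_pos: "0 < p" using m0 by (simp add: p_def)
    have p: "p \<le> plan (V t) i j" if "(i, j) \<in> tight" for t i j
    proof -
      have "p \<le> exp (V t i j) * (\<mu> i * \<nu> j)"
        unfolding p_def using low[OF that] m0 m0_le by (intro mult_mono) auto
      then show ?thesis using that by (simp add: plan_def tight_def mult.assoc)
    qed
    have M: "1 + 4 * \<Gamma>\<^sup>2 * real CARD('n) / p \<le> exp (R * (1 + \<delta>))"
    proof -
      let ?z = "(2 * \<delta> + c) / p0"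
      have z0: "0 \<le> ?z" using \<delta> c0 p0 by simp
      have "4 * \<Gamma>\<^sup>2 * real CARD('n) / p = H * exp ?z"
        by (simp add: p_def H_def exp_minus field_simps)
      then have "1 + 4 * \<Gamma>\<^sup>2 * real CARD('n) / p \<le> (1 + H) * exp ?z"
        using z0 by (simp add: distrib_right)
      also have "\<dots> \<le> exp H * exp ?z" by (intro mult_right_mono exp_ge_add_one_self) auto
      also have "\<dots> = exp (H * 1 + ?z)" by (simp add: exp_add)
      also have "\<dots> \<le> exp (H * (1 + \<delta>) + (c + 2) / p0 * (1 + \<delta>))"
      proof (subst exp_le_cancel_iff, intro add_mono)
        show "?z \<le> (c + 2) / p0 * (1 + \<delta>)"
          using scale[OF c0] p0 by (simp add: divide_right_mono add.commute)
      qed (use H \<delta> in \<open>auto intro!: mult_left_mono\<close>)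
      finally show ?thesis by (simp add: R_def distrib_right)
    qed
    have rec: "gap t \<le> exp (R * (1 + \<delta>)) * (gap t - gap (Suc t) + leak (V t))" for t
    proof -
      have "A l - A t \<le> (1 + 4 * \<Gamma>\<^sup>2 * real CARD('n) / p) * (x t + leak (V t))" if lt: "t \<le> l" for l
      proof -
        obtain a b where ab: "\<And>i j. V l i j = V t i j + (a i + b j)"
          using orbit_difference[of t "l - t" "row_step U"] lt by (auto simp: V_def)
        show ?thesis unfolding A_def x_def
          by (rule ascent_bounds_gap[OF Q Vn Vn ab p_pos p p \<Gamma>])
      qed
      then have "\<exists>N. \<forall>l\<ge>N. A l - A t \<le> (1 + 4 * \<Gamma>\<^sup>2 * real CARD('n) / p) * (x t + leak (V t))" by blast
      moreover have "(\<lambda>l. A l - A t) \<longlonglongrightarrow> L - A t" by (intro tendsto_intros L)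
      ultimately have "gap t \<le> (1 + 4 * \<Gamma>\<^sup>2 * real CARD('n) / p) * (x t + leak (V t))"
        unfolding gap_def by (intro LIMSEQ_le_const2)
      also have "\<dots> \<le> exp (R * (1 + \<delta>)) * (x t + leak (V t))"
        using xy(1)[of t] leak_nonneg[of "V t"] by (intro mult_right_mono M) auto
      also have "\<dots> \<le> exp (R * (1 + \<delta>)) * (gap t - gap (Suc t) + leak (V t))"
        using inc[of t] xy(2)[of t] by (intro mult_left_mono) (auto simp: gap_def)
      finally show ?thesis .
    qed
    have leakV: "leak (V t) \<le> exp (C * (1 + \<delta>) - \<rho> / 2 * real t)" for t
    proof -
      have "leak (V t) \<le> (\<Sum>i\<in>UNIV. \<Sum>j\<in>UNIV. exp (C * (1 + \<delta>) - \<rho> / 2 * real t) * (\<mu> i * \<nu> j))"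
        unfolding leak_def
      proof (intro sum_mono)
        fix i j
        let ?r = "exp (C * (1 + \<delta>) - \<rho> / 2 * real t) * (\<mu> i * \<nu> j)"
        have r0: "0 \<le> ?r" using mu_pos[of i] nu_pos[of j] by simp
        show "(if (i, j) \<in> tight then 0 else plan (V t) i j) \<le> ?r"
        proof (cases "(i, j) \<in> E \<and> (i, j) \<notin> tight")
          case True
          have "V t i j \<le> row_step U i j + real t * (v i + w j + 2 * (\<rho> / 4)) + (A t - A 0) / k"
            using logit_drift[OF Q row_normalised_row_step[of U] _ \<kappa>, of "\<rho> / 4" t i j] \<rho>
            by (simp add: V_def A_def k_def)
          moreover have "real t * (v i + w j + 2 * (\<rho> / 4)) \<le> real t * (- (\<rho> / 2))"
            using \<rho>_gap[of i j] True by (intro mult_left_mono) auto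
          moreover have "(A t - A 0) / k \<le> (c + 2) / k * (1 + \<delta>)"
            using Ac[of t] A0 scale[OF c0] k by (simp add: divide_right_mono)
          moreover have "row_step U i j \<le> c" using Vc[of i j 0] True by (simp add: V_def)
          moreover have "c \<le> c * (1 + \<delta>)" using c0 \<delta> by (simp add: algebra_simps)
          ultimately have "V t i j \<le> c * (1 + \<delta>) + (c + 2) / k * (1 + \<delta>) + real t * (- (\<rho> / 2))" by linarith
          also have "\<dots> = C * (1 + \<delta>) - \<rho> / 2 * real t" unfolding C_def by (simp only: distrib_right) simp
          finally have "exp (V t i j) * (\<mu> i * \<nu> j) \<le> ?r"
            using mu_pos[of i] nu_pos[of j] by (intro mult_right_mono) auto
          then show ?thesis using True by (simp add: plan_def mult.assoc)
        next
          case False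
          then have "(if (i, j) \<in> tight then 0 else plan (V t) i j) = 0" by (simp add: plan_def)
          then show ?thesis using r0 by simp
        qed
      qed
      also have "\<dots> = exp (C * (1 + \<delta>) - \<rho> / 2 * real t)"
        by (simp add: sum_mu sum_nu flip: sum_distrib_left)
      finally show ?thesis .
    qed
    define \<theta> where "\<theta> = exp (- (R' * (1 + \<delta>)))"
    have \<theta>: "0 < \<theta>" "\<theta> \<le> 1" using R' \<delta> by (auto simp: \<theta>_def)
    have gap: "gap t \<le> B * (1 + \<delta>) * (1 - \<theta>) ^ t"
      unfolding \<theta>_def
    proof (rule decay[rule_format, of \<delta> gap "\<lambda>t. leak (V t)", OF \<delta> _ _ _ leakV rec])
      show "0 \<le> gap t" for t using L(2)[of t] by (simp add: gap_def)
      show "decseq gap" using A_mono by (auto simp: decseq_def gap_def)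
      show "gap 0 \<le> (c + 2) * (1 + \<delta>)" using Lc A0 scale[OF c0] by (simp add: gap_def)
    qed
    have dev: "\<bar>d\<bar> \<le> B' * (1 + \<delta>) * (1 - exp (- ((R' + 3) * (1 + \<delta>)))) ^ (2 * t + 4)"
      if "\<kappa> * excess d \<le> gap t" for d
    proof -
      define r where "r = sqrt (1 - \<theta>)"
      define b where "b = B / \<kappa> * (1 + \<delta>)"
      have b0: "0 \<le> b" using B \<kappa> \<delta> by (simp add: b_def)
      have r: "0 \<le> r" "r \<le> 1" using \<theta> by (auto simp: r_def)
      have "1 - \<theta> = r * r" using \<theta>(2) by (simp add: r_def)
      then have r2: "(1 - \<theta>) ^ t = (r ^ t)\<^sup>2" by (simp add: power_mult_distrib power2_eq_square)
      have rt: "0 \<le> r ^ t" "r ^ t \<le> 1" using r by (auto simp: power_le_one)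
      have "excess d \<le> gap t / \<kappa>" using that \<kappa> by (simp add: field_simps)
      also have "\<dots> \<le> b * (r ^ t)\<^sup>2" using gap \<kappa>(1) by (simp add: b_def divide_right_mono flip: r2)
      finally have "\<bar>d\<bar> \<le> 4 * sqrt (b * (r ^ t)\<^sup>2) + b * (r ^ t)\<^sup>2" by (rule abs_le_of_excess_le)
      also have "\<dots> = (4 * sqrt b) * r ^ t + b * (r ^ t * r ^ t)"
        using rt by (simp add: real_sqrt_mult power2_eq_square)
      also have "\<dots> \<le> (4 * (b + 1)) * r ^ t + b * (r ^ t * 1)"
      proof (intro add_mono mult_right_mono mult_left_mono)
        have "b \<le> (b + 1)\<^sup>2" using b0 by (simp add: power2_eq_square algebra_simps)
        then show "sqrt b \<le> b + 1" using b0 by (intro real_le_lsqrt) auto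
      qed (use rt b0 in auto)
      also have "\<dots> \<le> 5 * (b + 1) * r ^ t" using rt by (simp add: algebra_simps)
      also have "\<dots> \<le> 5 * (b + 1) * (16 * (1 - exp (- ((R' + 3) * (1 + \<delta>)))) ^ (2 * t + 4))"
        unfolding r_def
      proof (intro mult_left_mono half_rate_power[OF \<theta>])
        have "exp (- ((R' + 3) * (1 + \<delta>))) = \<theta> * exp (- (3 * (1 + \<delta>)))"
          by (simp add: \<theta>_def algebra_simps flip: exp_add)
        also have "\<dots> \<le> \<theta> * (1 / 8)"
        proof (rule mult_left_mono)
          have "2 \<le> exp (1::real)" using exp_ge_add_one_self[of "1::real"] by simp
          then have "2 ^ 3 \<le> exp (1::real) ^ 3" by (intro power_mono) auto
          also have "\<dots> = exp 3" by (simp flip: exp_of_nat_mult)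
          also have "\<dots> \<le> exp (3 * (1 + \<delta>))" using \<delta> by simp
          finally have "inverse (exp (3 * (1 + \<delta>))) \<le> inverse (2 ^ 3)"
            by (intro le_imp_inverse_le) auto
          moreover have "inverse (2 ^ 3) = (1 / 8 :: real)" by simp
          ultimately show "exp (- (3 * (1 + \<delta>))) \<le> 1 / 8" by (simp only: exp_minus)
        qed (use \<theta> in auto)
        finally show "1 - \<theta> / 8 \<le> 1 - exp (- ((R' + 3) * (1 + \<delta>)))" by simp
      qed (use b0 in auto)
      also have "\<dots> \<le> B' * (1 + \<delta>) * (1 - exp (- ((R' + 3) * (1 + \<delta>)))) ^ (2 * t + 4)"
      proof -
        have "80 * (b + 1) \<le> B' * (1 + \<delta>)" using \<delta> by (simp add: B'_def b_def algebra_simps)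
        moreover have "0 \<le> (1 - exp (- ((R' + 3) * (1 + \<delta>)))) ^ (2 * t + 4)"
          using R' \<delta> by (intro zero_le_power) auto
        moreover have "5 * (b + 1) * (16 * z) = 80 * (b + 1) * z" for z by simp
        ultimately show ?thesis by (simp only:) (rule mult_right_mono)
      qed
      finally show ?thesis .
    qed
    have "A (Suc t) - A t \<le> gap t" using L(2) by (simp add: gap_def)
    then have total: "x t \<le> gap t" "y t \<le> gap t" using inc[of t] xy[of t] by linarith+
    have "\<kappa> * excess (col_dev (V t) j) \<le> nu_eq j * excess (col_dev (V t) j)"
      using \<kappa> by (intro mult_right_mono excess_nonneg)
    also have "\<dots> \<le> x t" unfolding x_def
      by (rule member_le_sum) (auto simp: less_imp_le[OF nu_eq_pos] excess_nonneg)
    also note total(1)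
    finally have col: "\<kappa> * excess (col_dev (V t) j) \<le> gap t" .
    have "\<kappa> * excess (row_dev (V t) i) \<le> \<mu> i * excess (row_dev (V t) i)"
      using \<kappa> by (intro mult_right_mono excess_nonneg)
    also have "\<dots> \<le> y t" unfolding y_def
      by (rule member_le_sum) (auto simp: less_imp_le[OF mu_pos] excess_nonneg)
    also note total(2)
    finally have row: "\<kappa> * excess (row_dev (V t) i) \<le> gap t" .
    show ?thesis using dev[OF col] dev[OF row] by (simp add: V_def)
  qed
  show ?thesis
    by (rule exI[of _ B'], rule exI[of _ "R' + 3"]) (use main B' R' in auto)
qed

end

section \<open>Existence and identification of the equilibrium\<close>

text \<open>Compactness of this set provides both the minimiser below and cluster points of the iteration.\<close>

definition row_plans :: "('m::finite \<Rightarrow> real) \<Rightarrow> ('m \<times> 'n::finite) set \<Rightarrow> (real ^ 'n ^ 'm) set" where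
  "row_plans \<mu> E = {P. (\<forall>i j. 0 \<le> P $ i $ j) \<and> (\<forall>i j. (i, j) \<notin> E \<longrightarrow> P $ i $ j = 0) \<and>
     (\<forall>i. (\<Sum>j\<in>UNIV. P $ i $ j) = \<mu> i)}"

lemma compact_row_plans:
  fixes E :: "('m::finite \<times> 'n::finite) set"
  shows "compact (row_plans \<mu> E)"
proof (rule compact_eq_bounded_closed[THEN iffD2], intro conjI)
  show "closed (row_plans \<mu> E)" unfolding row_plans_def
    by (intro closed_Collect_conj closed_Collect_all closed_Collect_imp open_Collect_const
        closed_Collect_le closed_Collect_eq continuous_intros)
  show "bounded (row_plans \<mu> E)"
  proof (rule boundedI)
    fix P :: "real ^ 'n ^ 'm" assume P: "P \<in> row_plans \<mu> E"
    have "norm P \<le> (\<Sum>i\<in>UNIV. norm (P $ i))" unfolding norm_vec_def by (rule L2_set_le_sum) auto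
    also have "\<dots> \<le> (\<Sum>i\<in>UNIV. \<mu> i)"
    proof (rule sum_mono)
      fix i
      have "norm (P $ i) \<le> (\<Sum>j\<in>UNIV. norm (P $ i $ j))"
        unfolding norm_vec_def by (rule L2_set_le_sum) auto
      also have "\<dots> = \<mu> i" using P by (simp add: row_plans_def)
      finally show "norm (P $ i) \<le> \<mu> i" .
    qed
    finally show "norm P \<le> (\<Sum>i\<in>UNIV. \<mu> i)" .
  qed
qed

text \<open>The minimiser of \<open>\<Sum>j. (n j)\<^sup>2 / \<nu> j\<close>, where \<open>n\<close> is the column marginal. Replacing the relative
  entropy by this quadratic objective gives the same optimality conditions, as only the monotonicity of the
  derivative in \<open>n j / \<nu> j\<close> matters: mass moves within a row towards columns with a smaller ratio. The
  derivative is finite at \<open>0\<close>, so columns without mass need no special treatment.\<close>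

lemma (in weighted_graph) row_plan_minimiser:
  obtains P where "P \<in> row_plans \<mu> E"
    and "\<And>i j j'. 0 < P $ i $ j \<Longrightarrow> (i, j') \<in> E \<Longrightarrow>
      (\<Sum>i\<in>UNIV. P $ i $ j) / \<nu> j \<le> (\<Sum>i\<in>UNIV. P $ i $ j') / \<nu> j'"
proof -
  let ?n = "\<lambda>P :: real ^ 'n ^ 'm. \<lambda>j. \<Sum>i\<in>UNIV. P $ i $ j"
  define F where "F P = (\<Sum>j\<in>UNIV. (?n P j)\<^sup>2 / \<nu> j)" for P
  obtain J where J: "\<And>i. (i, J i) \<in> E" using row_nonempty by metis
  have "(\<chi> i j. if j = J i then \<mu> i else 0) \<in> row_plans \<mu> E"
    using J mu_pos by (auto simp: row_plans_def less_imp_le)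
  then have "row_plans \<mu> E \<noteq> {}" by blast
  moreover have "continuous_on (row_plans \<mu> E) F"
    unfolding F_def using nu_pos by (intro continuous_intros) (metis less_irrefl)
  ultimately obtain P where P: "P \<in> row_plans \<mu> E" and min: "\<And>P'. P' \<in> row_plans \<mu> E \<Longrightarrow> F P \<le> F P'"
    using continuous_attains_inf[OF compact_row_plans] by blast
  show thesis
  proof (rule that[OF P])
    fix i0 j0 j1 assume pos: "0 < P $ i0 $ j0" and j1: "(i0, j1) \<in> E"
    show "?n P j0 / \<nu> j0 \<le> ?n P j1 / \<nu> j1"
    proof (rule ccontr)
      assume less: "\<not> ?thesis"
      then have neq: "j0 \<noteq> j1" by auto
      define s where "s = ?n P j0 / \<nu> j0 - ?n P j1 / \<nu> j1"
      define T where "T = 1 / \<nu> j0 + 1 / \<nu> j1"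
      have s: "0 < s" using less by (simp add: s_def)
      have T: "0 < T" using nu_pos by (simp add: T_def add_pos_pos)
      \<comment> \<open>Moving \<open>\<epsilon>\<close> from column \<open>j0\<close> to \<open>j1\<close> changes the objective by \<open>- 2 \<epsilon> s + \<epsilon>\<^sup>2 T\<close>.\<close>
      define \<epsilon> where "\<epsilon> = min (P $ i0 $ j0) (s / T)"
      have \<epsilon>: "0 < \<epsilon>" "\<epsilon> \<le> P $ i0 $ j0" "\<epsilon> * T \<le> s"
        using pos s T by (auto simp: \<epsilon>_def min_def field_simps)
      define d where "d j = (if j = j1 then 1 else 0) - (if j = j0 then 1 else 0 :: real)" for j
      define P' :: "real ^ 'n ^ 'm" where
        "P' = (\<chi> i j. P $ i $ j + (if i = i0 then \<epsilon> * d j else 0))"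
      have j0: "(i0, j0) \<in> E" using P pos by (force simp: row_plans_def)
      have "P' \<in> row_plans \<mu> E" unfolding row_plans_def
      proof (intro CollectI conjI allI impI)
        fix i j show "0 \<le> P' $ i $ j"
          using P \<epsilon> pos by (auto simp: P'_def row_plans_def d_def)
      next
        fix i j assume "(i, j) \<notin> E"
        then show "P' $ i $ j = 0" using P j0 j1 by (auto simp: P'_def row_plans_def d_def)
      next
        fix i
        have "(\<Sum>j\<in>UNIV. d j) = 0" by (simp add: d_def sum_subtractf)
        then show "(\<Sum>j\<in>UNIV. P' $ i $ j) = \<mu> i"
          using P by (cases "i = i0") (simp_all add: P'_def row_plans_def sum.distrib flip: sum_distrib_left)
      qed
      then have "F P \<le> F P'" by (rule min)
      also have "F P' = (\<Sum>j\<in>UNIV. (?n P j)\<^sup>2 / \<nu> j + (2 * \<epsilon> * (?n P j / \<nu> j) * d j + \<epsilon>\<^sup>2 * ((d j)\<^sup>2 / \<nu> j)))"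
      proof -
        have "?n P' j = ?n P j + \<epsilon> * d j" for j by (simp add: P'_def sum.distrib)
        then show ?thesis unfolding F_def
          by (intro sum.cong refl) (simp add: power2_eq_square algebra_simps add_divide_distrib)
      qed
      also have "\<dots> = F P + (2 * \<epsilon> * (\<Sum>j\<in>UNIV. (?n P j / \<nu> j) * d j) + \<epsilon>\<^sup>2 * (\<Sum>j\<in>UNIV. (d j)\<^sup>2 / \<nu> j))"
      proof -
        have "(\<Sum>j\<in>UNIV. a j + (2 * \<epsilon> * b j * d j + \<epsilon>\<^sup>2 * e j)) =
          (\<Sum>j\<in>UNIV. a j) + (2 * \<epsilon> * (\<Sum>j\<in>UNIV. b j * d j) + \<epsilon>\<^sup>2 * (\<Sum>j\<in>UNIV. e j))"
          for a b e :: "'n \<Rightarrow> real" by (simp add: sum.distrib sum_distrib_left mult.assoc)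
        then show ?thesis by (simp only: F_def)
      qed
      also have "(\<Sum>j\<in>UNIV. (?n P j / \<nu> j) * d j) = - s"
      proof -
        have "(?n P j / \<nu> j) * d j = (if j = j1 then ?n P j / \<nu> j else 0) - (if j = j0 then ?n P j / \<nu> j else 0)" for j
          by (simp add: d_def)
        then show ?thesis by (simp add: sum_subtractf s_def)
      qed
      also have "(\<Sum>j\<in>UNIV. (d j)\<^sup>2 / \<nu> j) = T"
      proof -
        have "(d j)\<^sup>2 / \<nu> j = (if j = j1 then 1 / \<nu> j else 0) + (if j = j0 then 1 / \<nu> j else 0)" for j
          using neq by (simp add: d_def)
        then show ?thesis by (simp add: sum.distrib T_def)
      qed
      finally have "0 \<le> \<epsilon> * (\<epsilon> * T - 2 * s)" by (simp add: power2_eq_square algebra_simps)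
      then show False using \<epsilon> s by (simp add: zero_le_mult_iff)
    qed
  qed
qed

text \<open>Every row puts its mass on the neighbouring columns of minimal ratio \<open>n j / \<nu> j\<close>. A column
  without mass would have ratio \<open>0\<close> and would attract mass, so all columns are charged and
  \<open>w j = ln (\<nu> j / n j)\<close> is well defined; \<open>- v i\<close> is its common value on the columns that row \<open>i\<close>
  charges.\<close>

lemma (in weighted_graph) equilibrium_exists:
  obtains v w Q where "equilibrium \<mu> \<nu> E v w" "equilibrium.equilibrium_plan \<mu> \<nu> E v w Q"
proof -
  obtain P where P: "P \<in> row_plans \<mu> E"
    and opt: "\<And>i j j'. 0 < P $ i $ j \<Longrightarrow> (i, j') \<in> E \<Longrightarrow>
      (\<Sum>i\<in>UNIV. P $ i $ j) / \<nu> j \<le> (\<Sum>i\<in>UNIV. P $ i $ j') / \<nu> j'"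
    using row_plan_minimiser by blast
  define n where "n j = (\<Sum>i\<in>UNIV. P $ i $ j)" for j
  have nonneg: "0 \<le> P $ i $ j" for i j using P by (simp add: row_plans_def)
  have "\<exists>j. 0 < P $ i $ j" for i
  proof (rule ccontr)
    assume "\<nexists>j. 0 < P $ i $ j"
    then have "P $ i $ j = 0" for j using nonneg[of i j] by (metis less_eq_real_def)
    then have "(\<Sum>j\<in>UNIV. P $ i $ j) = 0" by (intro sum.neutral ballI)
    moreover have "(\<Sum>j\<in>UNIV. P $ i $ j) = \<mu> i" using P by (simp add: row_plans_def)
    ultimately show False using mu_pos[of i] by simp
  qed
  then obtain J where J: "\<And>i. 0 < P $ i $ J i" by metis
  have n_pos: "0 < n j" for j
  proof -
    obtain i where ij: "(i, j) \<in> E" using col_nonempty by blast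
    have "0 < n (J i)" unfolding n_def using J nonneg by (intro sum_pos2[of _ i]) auto
    then have "0 < n (J i) / \<nu> (J i)" using nu_pos by simp
    also have "\<dots> \<le> n j / \<nu> j" unfolding n_def by (rule opt[OF J ij])
    finally show ?thesis using nu_pos[of j] by (simp add: zero_less_divide_iff)
  qed
  define w where "w j = ln (\<nu> j / n j)" for j
  define v where "v i = - w (J i)" for i
  have w_mono: "w j' \<le> w j" if "0 < P $ i $ j" "(i, j') \<in> E" for i j j'
  proof -
    have "\<nu> j' / n j' \<le> \<nu> j / n j"
      using opt[OF that, folded n_def] n_pos[of j] n_pos[of j'] nu_pos[of j] nu_pos[of j']
      by (simp add: field_simps)
    then show ?thesis unfolding w_def
      by (subst ln_le_cancel_iff) (use n_pos nu_pos in auto)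
  qed
  have E: "(i, j) \<in> E" if "0 < P $ i $ j" for i j using P that by (force simp: row_plans_def)
  interpret eq: equilibrium \<mu> \<nu> E v w
    by unfold_locales (simp add: v_def w_mono[OF J])
  have "eq.equilibrium_plan (\<lambda>i j. P $ i $ j)" unfolding eq.equilibrium_plan_def
  proof (intro conjI allI impI)
    fix i j assume nt: "(i, j) \<notin> eq.tight"
    show "P $ i $ j = 0"
    proof (rule ccontr)
      assume "P $ i $ j \<noteq> 0"
      then have pos: "0 < P $ i $ j" using nonneg[of i j] by simp
      have "w j = w (J i)" using w_mono[OF J E[OF pos]] w_mono[OF pos E[OF J]] by simp
      with nt E[OF pos] show False by (simp add: eq.tight_def v_def)
    qed
  next
    fix j show "(\<Sum>i\<in>UNIV. P $ i $ j) = eq.nu_eq j"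
      using n_pos[of j] nu_pos[of j] by (simp add: eq.nu_eq_def w_def exp_minus flip: n_def)
  qed (use P in \<open>auto simp: row_plans_def\<close>)
  with eq.equilibrium_axioms show thesis by (rule that)
qed

text \<open>Gibbs' inequality term by term, with its case of equality.\<close>

lemma mult_ln_ge:
  fixes p q :: real
  assumes "0 \<le> p" "0 < q"
  shows "p - q \<le> p * ln (p / q)" and "p * ln (p / q) = p - q \<Longrightarrow> p = q"
proof -
  have 1: "p * ln (p / q) = - (p * ln (q / p))" if "0 < p"
    using that assms by (simp add: ln_div algebra_simps)
  show "p - q \<le> p * ln (p / q)"
  proof (cases "p = 0")
    case False
    then have p: "0 < p" using assms by simp
    have "p * ln (q / p) \<le> p * (q / p - 1)" using p assms by (intro mult_left_mono ln_le_minus_one) auto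
    then show ?thesis using p by (simp add: 1 algebra_simps)
  qed (use assms in simp)
  show "p = q" if eq: "p * ln (p / q) = p - q"
  proof (cases "p = 0")
    case False
    then have p: "0 < p" using assms by simp
    then have "ln (q / p) = q / p - 1" using eq by (simp add: 1 field_simps)
    then have "q / p = 1" using p assms by (intro ln_eq_minus_one) auto
    then show ?thesis using p by simp
  qed (use eq in simp)
qed

text \<open>Sufficiency of the optimality conditions. Since \<open>ln (x0 / q) = - u\<close>, the entropy of \<open>x\<close> with respect
  to \<open>q\<close> is its entropy with respect to \<open>x0\<close> minus the \<open>x\<close>-average of \<open>u\<close>; the first term is
  nonnegative and vanishes only at \<open>x0\<close>, the subtracted average is largest at \<open>x0\<close>.\<close>

lemma arg_min_rel_entropy:
  fixes q x0 :: "real ^ 'a"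
  assumes q: "\<And>i. 0 < q $ i" and x0: "x0 = (\<chi> i. q $ i * exp (- u i))" and F0: "F x0"
    and F: "\<And>x i. F x \<Longrightarrow> 0 \<le> x $ i"
      "\<And>x. F x \<Longrightarrow> (\<Sum>i\<in>UNIV. x $ i) = (\<Sum>i\<in>UNIV. x0 $ i)"
      "\<And>x. F x \<Longrightarrow> (\<Sum>i\<in>UNIV. x $ i * u i) \<le> (\<Sum>i\<in>UNIV. x0 $ i * u i)"
  shows "arg_min (\<lambda>x. rel_entropy x q) F = x0"
proof -
  have pos: "0 < x0 $ i" for i using q[of i] by (simp add: x0)
  have split: "rel_entropy x q = (\<Sum>i\<in>UNIV. x $ i * ln (x $ i / x0 $ i)) - (\<Sum>i\<in>UNIV. x $ i * u i)"
    if "F x" for x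
  proof -
    have "x $ i * ln (x $ i / q $ i) = x $ i * ln (x $ i / x0 $ i) - x $ i * u i" for i
    proof (cases "x $ i = 0")
      case False
      then have "0 < x $ i" using F(1)[OF that, of i] by simp
      then show ?thesis using q[of i] by (simp add: x0 ln_div ln_mult algebra_simps)
    qed simp
    then show ?thesis by (simp add: rel_entropy_def sum_subtractf)
  qed
  have rel0: "rel_entropy x0 q = - (\<Sum>i\<in>UNIV. x0 $ i * u i)"
    using split[OF F0] pos by (simp add: less_imp_neq[symmetric])
  have ge: "x $ i - x0 $ i \<le> x $ i * ln (x $ i / x0 $ i)" if "F x" for x i
    using mult_ln_ge(1)[OF F(1)[OF that] pos] by simp
  have zero: "(\<Sum>i\<in>UNIV. x $ i - x0 $ i) = 0" if "F x" for x
    using F(2)[OF that] by (simp add: sum_subtractf)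
  have le: "rel_entropy x0 q \<le> rel_entropy x q" if "F x" for x
    using sum_mono[of UNIV "\<lambda>i. x $ i - x0 $ i" "\<lambda>i. x $ i * ln (x $ i / x0 $ i)"] ge[OF that]
      zero[OF that] split[OF that] F(3)[OF that] rel0 by simp
  have uniq: "x = x0" if x: "F x" and xle: "rel_entropy x q \<le> rel_entropy x0 q" for x
  proof -
    have "(\<Sum>i\<in>UNIV. x $ i * ln (x $ i / x0 $ i) - (x $ i - x0 $ i)) \<le> 0"
      using split[OF x] F(3)[OF x] rel0 xle zero[OF x] by (simp add: sum_subtractf)
    moreover have "0 \<le> x $ i * ln (x $ i / x0 $ i) - (x $ i - x0 $ i)" for i using ge[OF x, of i] by simp
    ultimately have "x $ i * ln (x $ i / x0 $ i) - (x $ i - x0 $ i) = 0" for i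
      using sum_nonneg_eq_0_iff[of UNIV "\<lambda>i. x $ i * ln (x $ i / x0 $ i) - (x $ i - x0 $ i)"]
      by (meson UNIV_I antisym finite sum_nonneg)
    then have "x $ i = x0 $ i" for i
      using mult_ln_ge(2)[OF F(1)[OF x] pos, of i] by simp
    then show ?thesis by (simp add: vec_eq_iff)
  qed
  have "is_arg_min (\<lambda>x. rel_entropy x q) F x0" using F0 le by (auto simp: is_arg_min_def not_less)
  moreover have "x = x0" if "is_arg_min (\<lambda>x. rel_entropy x q) F x" for x
    using that F0 by (intro uniq) (auto simp: is_arg_min_def not_less)
  ultimately show ?thesis unfolding arg_min_def by (rule some_equality)
qed

lemma X_marginal_plan: "P \<in> plans E \<Longrightarrow> X_marginal E P $ i = (\<Sum>j\<in>UNIV. P $ i $ j)"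
  unfolding X_marginal_def by (simp, rule sum.mono_neutral_left) (auto simp: plans_def)

lemma Y_marginal_plan: "P \<in> plans E \<Longrightarrow> Y_marginal E P $ j = (\<Sum>i\<in>UNIV. P $ i $ j)"
  unfolding Y_marginal_def by (simp, rule sum.mono_neutral_left) (auto simp: plans_def)

lemma (in equilibrium) plan_drift_nonpos:
  assumes "P \<in> plans E"
  shows "(\<Sum>i\<in>UNIV. X_marginal E P $ i * v i) + (\<Sum>j\<in>UNIV. Y_marginal E P $ j * w j) \<le> 0"
proof -
  have "(\<Sum>i\<in>UNIV. \<Sum>j\<in>UNIV. P $ i $ j * (v i + w j)) \<le> 0"
  proof (intro sum_nonpos)
    fix i j show "P $ i $ j * (v i + w j) \<le> 0"
      using assms drift_nonpos[of i j] by (cases "(i, j) \<in> E") (auto simp: plans_def mult_nonneg_nonpos)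
  qed
  then show ?thesis unfolding sum_pairing X_marginal_plan[OF assms] Y_marginal_plan[OF assms] .
qed

text \<open>One equilibrium plan \<open>Q\<close> certifies both minimisers: \<open>Q\<close> itself has marginals \<open>\<mu>\<close> and
  \<open>\<nu> exp (- w)\<close>, and the plan \<open>Q i j exp (- v i) = Q i j exp (w j)\<close> has marginals \<open>\<mu> exp (- v)\<close>
  and \<open>\<nu>\<close>. In both cases the linear inequality comes from the sign of the drift.\<close>

lemma star_eq_equilibrium:
  fixes \<mu> :: "real ^ 'm" and \<nu> :: "real ^ 'n"
  assumes "equilibrium (\<lambda>i. \<mu> $ i) (\<lambda>j. \<nu> $ j) E v w"
    and "equilibrium.equilibrium_plan (\<lambda>i. \<mu> $ i) (\<lambda>j. \<nu> $ j) E v w Q"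
  shows "v_star \<mu> \<nu> E = (\<chi> i. v i)" and "w_star \<mu> \<nu> E = (\<chi> j. w j)"
proof -
  interpret equilibrium "\<lambda>i. \<mu> $ i" "\<lambda>j. \<nu> $ j" E v w by (rule assms)
  have Q: "equilibrium_plan Q" by (rule assms)
  have Q0: "Q i j = 0" if "(i, j) \<notin> tight" for i j using Q that by (simp add: equilibrium_plan_def)
  have drift0: "(\<Sum>i\<in>UNIV. \<mu> $ i * v i) + (\<Sum>j\<in>UNIV. nu_eq j * w j) = 0"
    using mean_logit_pairing[OF Q, of v w] mean_logit_drift[OF Q] by simp
  define P :: "real ^ 'n ^ 'm" where "P = (\<chi> i j. Q i j)"
  define P' :: "real ^ 'n ^ 'm" where "P' = (\<chi> i j. Q i j * exp (- v i))"
  have P'w: "P' $ i $ j = Q i j * exp (w j)" for i j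
    using Q0[of i j] by (cases "(i, j) \<in> tight") (auto simp: P'_def tight_def add_eq_0_iff)
  have rowQ: "(\<Sum>j\<in>UNIV. Q i j) = \<mu> $ i" and colQ: "(\<Sum>i\<in>UNIV. Q i j) = nu_eq j" for i j
    using Q by (auto simp: equilibrium_plan_def)
  have P: "P \<in> plans E"
    using Q equilibrium_plan_mass[OF Q] by (auto simp: plans_def P_def equilibrium_plan_def tight_def)
  have rowP': "(\<Sum>j\<in>UNIV. P' $ i $ j) = \<mu> $ i * exp (- v i)" for i
    by (simp add: P'_def rowQ flip: sum_distrib_right)
  have colP': "(\<Sum>i\<in>UNIV. P' $ i $ j) = \<nu> $ j" for j
    by (simp add: P'w colQ nu_eq_def exp_minus flip: sum_distrib_right)
  have "(\<Sum>i\<in>UNIV. \<Sum>j\<in>UNIV. P' $ i $ j) = 1"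
    by (subst sum.swap) (simp add: colP' sum_nu)
  then have P': "P' \<in> plans E"
    using Q Q0 by (auto simp: plans_def P'_def equilibrium_plan_def tight_def)
  have mass: "(\<Sum>i\<in>UNIV. X_marginal E P $ i) = 1" "(\<Sum>j\<in>UNIV. Y_marginal E P $ j) = 1"
    "0 \<le> X_marginal E P $ i" "0 \<le> Y_marginal E P $ j" if "P \<in> plans E" for P i j
  proof -
    show "(\<Sum>i\<in>UNIV. X_marginal E P $ i) = 1" using that by (simp add: X_marginal_plan) (simp add: plans_def)
    then show "(\<Sum>j\<in>UNIV. Y_marginal E P $ j) = 1" using that
      by (simp add: X_marginal_plan Y_marginal_plan) (subst sum.swap, simp)
    show "0 \<le> X_marginal E P $ i" "0 \<le> Y_marginal E P $ j"
      using that by (auto simp: X_marginal_plan Y_marginal_plan intro!: sum_nonneg) (auto simp: plans_def)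
  qed
  have "nu_star \<mu> \<nu> E = (\<chi> j. \<nu> $ j * exp (- w j))"
    unfolding nu_star_def
  proof (rule arg_min_rel_entropy[of \<nu> _ w])
    have X: "X_marginal E P = \<mu>" by (simp add: vec_eq_iff X_marginal_plan[OF P]) (simp add: P_def rowQ)
    have Y: "Y_marginal E P = (\<chi> j. \<nu> $ j * exp (- w j))"
      by (simp add: vec_eq_iff Y_marginal_plan[OF P]) (simp add: P_def colQ nu_eq_def)
    show "\<exists>P\<in>plans E. X_marginal E P = \<mu> \<and> Y_marginal E P = (\<chi> j. \<nu> $ j * exp (- w j))"
      using P X Y by blast
    fix x assume "\<exists>P\<in>plans E. X_marginal E P = \<mu> \<and> Y_marginal E P = x"
    then obtain R where R: "R \<in> plans E" "X_marginal E R = \<mu>" "Y_marginal E R = x" by blast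
    show "0 \<le> x $ i" for i using mass(4)[OF R(1)] R by simp
    show "(\<Sum>i\<in>UNIV. x $ i) = (\<Sum>i\<in>UNIV. (\<chi> j. \<nu> $ j * exp (- w j)) $ i)"
      using mass(2)[OF R(1)] mass(2)[OF P] R Y by simp
    show "(\<Sum>i\<in>UNIV. x $ i * w i) \<le> (\<Sum>i\<in>UNIV. (\<chi> j. \<nu> $ j * exp (- w j)) $ i * w i)"
      using plan_drift_nonpos[OF R(1)] drift0 R by (simp add: nu_eq_def)
  qed (use nu_pos in auto)
  moreover have "\<nu> $ j / (\<nu> $ j * exp (- w j)) = exp (w j)" for j
    using nu_pos[of j] by (simp add: exp_minus divide_simps)
  ultimately show "w_star \<mu> \<nu> E = (\<chi> j. w j)" by (simp add: w_star_def vec_eq_iff)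
  have "mu_star \<mu> \<nu> E = (\<chi> i. \<mu> $ i * exp (- v i))"
    unfolding mu_star_def
  proof (rule arg_min_rel_entropy[of \<mu> _ v])
    have Y: "Y_marginal E P' = \<nu>" by (simp add: vec_eq_iff Y_marginal_plan[OF P'] colP')
    have X: "X_marginal E P' = (\<chi> i. \<mu> $ i * exp (- v i))"
      by (simp add: vec_eq_iff X_marginal_plan[OF P'] rowP')
    show "\<exists>Q\<in>plans E. X_marginal E Q = (\<chi> i. \<mu> $ i * exp (- v i)) \<and> Y_marginal E Q = \<nu>"
      using P' X Y by blast
    have "P' $ i $ j * (v i + w j) = 0" for i j
      using Q0[of i j] by (cases "(i, j) \<in> tight") (auto simp: P'_def tight_def)
    then have "(\<Sum>i\<in>UNIV. \<Sum>j\<in>UNIV. P' $ i $ j * (v i + w j)) = 0" by (intro sum.neutral ballI)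
    then have drift': "(\<Sum>i\<in>UNIV. \<mu> $ i * exp (- v i) * v i) + (\<Sum>j\<in>UNIV. \<nu> $ j * w j) = 0"
      unfolding sum_pairing rowP' colP' .
    fix x assume "\<exists>Q\<in>plans E. X_marginal E Q = x \<and> Y_marginal E Q = \<nu>"
    then obtain R where R: "R \<in> plans E" "X_marginal E R = x" "Y_marginal E R = \<nu>" by blast
    show "0 \<le> x $ i" for i using mass(3)[OF R(1)] R by simp
    show "(\<Sum>i\<in>UNIV. x $ i) = (\<Sum>i\<in>UNIV. (\<chi> i. \<mu> $ i * exp (- v i)) $ i)"
      using mass(1)[OF R(1)] mass(1)[OF P'] R X by simp
    show "(\<Sum>i\<in>UNIV. x $ i * v i) \<le> (\<Sum>i\<in>UNIV. (\<chi> i. \<mu> $ i * exp (- v i)) $ i * v i)"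
      using plan_drift_nonpos[OF R(1)] drift' R by simp
  qed (use mu_pos in auto)
  moreover have "\<mu> $ i / (\<mu> $ i * exp (- v i)) = exp (v i)" for i
    using mu_pos[of i] by (simp add: exp_minus divide_simps)
  ultimately show "v_star \<mu> \<nu> E = (\<chi> i. v i)" by (simp add: v_star_def vec_eq_iff)
qed

text \<open>The total ascent of \<open>mean_logit Q\<close> is finite, so the column errors tend to \<open>0\<close> and every cluster
  point of the plans has the marginals of an equilibrium plan. Having these marginals, its average drift is
  zero, so it charges tight edges only; and it charges all of them, because an entry whose logit
  converges stays away from \<open>0\<close>.\<close>

lemma (in equilibrium) full_plan_of_convergent_logits:
  assumes Q: "equilibrium_plan Q" and U: "row_normalised U"
    and lim: "\<And>i j. (i, j) \<in> tight \<Longrightarrow> \<exists>L. (\<lambda>t. (sweep ^^ t) U i j) \<longlonglongrightarrow> L"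
  obtains Q' where "equilibrium_plan Q'" "\<And>i j. (i, j) \<in> tight \<Longrightarrow> 0 < Q' i j"
proof -
  define V where "V t = (sweep ^^ t) U" for t
  define A where "A t = mean_logit Q (V t)" for t
  have Vn: "row_normalised (V t)" for t unfolding V_def by (intro row_normalised_orbit U)
  define c where "c = (\<Sum>j\<in>UNIV. \<bar>ln (\<nu> j)\<bar>)"
  have c: "- ln (\<nu> j) \<le> c" for j
    using member_le_sum[of j UNIV "\<lambda>j. \<bar>ln (\<nu> j)\<bar>"] by (simp add: c_def)
  have Ac: "A t \<le> c" for t unfolding A_def
    by (rule mean_logit_le[OF Q]) (rule order_trans[OF logit_upper[OF Vn] c])
  have "incseq A" by (auto simp: incseq_def A_def V_def intro: mean_logit_mono_orbit[OF Q U])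
  then obtain L where L: "A \<longlonglongrightarrow> L" using incseq_convergent[of A c] Ac by blast
  have "(\<lambda>t. A (Suc t) - A t) \<longlonglongrightarrow> L - L" by (intro tendsto_intros L LIMSEQ_Suc)
  then have A_diff: "(\<lambda>t. A (Suc t) - A t) \<longlonglongrightarrow> 0" by simp
  have dev: "(\<lambda>t. col_dev (V t) j) \<longlonglongrightarrow> 0" for j
  proof (rule Lim_null_comparison)
    show "\<forall>\<^sub>F t in sequentially. norm (col_dev (V t) j)
      \<le> 4 * sqrt ((A (Suc t) - A t) / nu_eq j) + (A (Suc t) - A t) / nu_eq j"
    proof (intro always_eventually allI)
      fix t
      have "nu_eq j * excess (col_dev (V t) j) \<le> (\<Sum>j\<in>UNIV. nu_eq j * excess (col_dev (V t) j))"
        by (rule member_le_sum) (auto simp: less_imp_le[OF nu_eq_pos] excess_nonneg)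
      also have "\<dots> \<le> A (Suc t) - A t"
        using mean_logit_sweep[OF Q Vn, of t] excess_sums_nonneg(1)[of "V t"] by (simp add: A_def V_def)
      finally have "excess (col_dev (V t) j) \<le> (A (Suc t) - A t) / nu_eq j"
        using nu_eq_pos[of j] by (simp add: field_simps)
      then show "norm (col_dev (V t) j) \<le> 4 * sqrt ((A (Suc t) - A t) / nu_eq j) + (A (Suc t) - A t) / nu_eq j"
        by (simp add: abs_le_of_excess_le)
    qed
    have "(\<lambda>t. 4 * sqrt ((A (Suc t) - A t) / nu_eq j) + (A (Suc t) - A t) / nu_eq j)
      \<longlonglongrightarrow> 4 * sqrt (0 / nu_eq j) + 0 / nu_eq j"
      using nu_eq_pos[of j] by (intro tendsto_intros A_diff) auto
    then show "(\<lambda>t. 4 * sqrt ((A (Suc t) - A t) / nu_eq j) + (A (Suc t) - A t) / nu_eq j) \<longlonglongrightarrow> 0" by simp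
  qed
  define P :: "nat \<Rightarrow> real ^ 'n ^ 'm" where "P t = (\<chi> i j. plan (V t) i j)" for t
  have "P t \<in> row_plans \<mu> E" for t
    using Vn[of t] by (auto simp: P_def row_plans_def plan_nonneg row_normalised_def plan_off)
  then obtain l r where l: "l \<in> row_plans \<mu> E" and r: "strict_mono r" and lim_l: "(P \<circ> r) \<longlonglongrightarrow> l"
    using seq_compactE[OF compact_imp_seq_compact[OF compact_row_plans], of P] by metis
  have lij: "(\<lambda>t. plan (V (r t)) i j) \<longlonglongrightarrow> l $ i $ j" for i j
    using tendsto_vec_nth[OF tendsto_vec_nth[OF lim_l]] by (simp add: P_def)
  have col: "(\<Sum>i\<in>UNIV. l $ i $ j) = nu_eq j" for j
  proof (rule LIMSEQ_unique)
    show "(\<lambda>t. \<Sum>i\<in>UNIV. plan (V (r t)) i j) \<longlonglongrightarrow> (\<Sum>i\<in>UNIV. l $ i $ j)"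
      by (intro tendsto_sum lij)
    have "(\<lambda>t. nu_eq j * exp (- col_dev (V (r t)) j)) \<longlonglongrightarrow> nu_eq j * exp (- 0)"
      using LIMSEQ_subseq_LIMSEQ[OF dev r] by (intro tendsto_intros) (simp add: o_def)
    then show "(\<lambda>t. \<Sum>i\<in>UNIV. plan (V (r t)) i j) \<longlonglongrightarrow> nu_eq j" by (simp add: exp_col_dev)
  qed
  have row: "(\<Sum>j\<in>UNIV. l $ i $ j) = \<mu> i" for i using l by (simp add: row_plans_def)
  have drift: "(\<Sum>i\<in>UNIV. \<Sum>j\<in>UNIV. l $ i $ j * - (v i + w j)) = 0"
  proof -
    have "(\<Sum>i\<in>UNIV. \<Sum>j\<in>UNIV. l $ i $ j * (v i + w j)) = 0"
      using mean_logit_pairing[OF Q, of v w] mean_logit_drift[OF Q] sum_pairing[of "\<lambda>i j. l $ i $ j" v w]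
      by (simp add: row col)
    then show ?thesis by (simp only: mult_minus_right sum_negf neg_0_equal_iff_equal)
  qed
  have nonneg: "0 \<le> l $ i $ j * - (v i + w j)" for i j
  proof (cases "(i, j) \<in> E")
    case True
    then show ?thesis using l drift_nonpos[OF True] unfolding row_plans_def
      by (intro mult_nonneg_nonneg) auto
  qed (use l in \<open>simp add: row_plans_def\<close>)
  have "equilibrium_plan (\<lambda>i j. l $ i $ j)" unfolding equilibrium_plan_def
  proof (intro conjI allI impI)
    fix i j assume nt: "(i, j) \<notin> tight"
    have "l $ i $ j * - (v i + w j) = 0"
      using term_le_double_sum[of "\<lambda>i j. l $ i $ j * - (v i + w j)", OF nonneg, of i j] nonneg[of i j] drift
      by linarith
    then show "l $ i $ j = 0" using nt l by (auto simp: tight_def row_plans_def)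
  qed (use l row col in \<open>auto simp: row_plans_def\<close>)
  moreover have "0 < l $ i $ j" if ij: "(i, j) \<in> tight" for i j
  proof -
    obtain L where L: "(\<lambda>t. V t i j) \<longlonglongrightarrow> L" using lim[OF ij] by (auto simp: V_def)
    have "(\<lambda>t. exp (V (r t) i j) * \<mu> i * \<nu> j) \<longlonglongrightarrow> exp L * \<mu> i * \<nu> j"
      using LIMSEQ_subseq_LIMSEQ[OF L r] by (intro tendsto_intros) (simp add: o_def)
    moreover have "plan (V (r t)) i j = exp (V (r t) i j) * \<mu> i * \<nu> j" for t
      using ij by (simp add: plan_def tight_def)
    ultimately have "l $ i $ j = exp L * \<mu> i * \<nu> j" using LIMSEQ_unique[OF lij[of i j]] by simp
    then show ?thesis using mu_pos[of i] nu_pos[of j] by simp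
  qed
  ultimately show thesis by (rule that)
qed

section \<open>The Sinkhorn algorithm\<close>

lemma infnorm_le_of_components:
  fixes x :: "real ^ 'n"
  assumes "\<And>i. \<bar>x $ i\<bar> \<le> b"
  shows "infnorm x \<le> b"
  unfolding infnorm_cart using assms by (intro cSup_least) auto

text \<open>An infinite cost becomes a vanishing kernel entry, so the sums over \<open>UNIV\<close> in the updates are sums
  over the edges.\<close>

lemma exp_ereal_cost:
  assumes "cost_on E C" and "0 < \<tau>"
  shows "exp_ereal ((- (C $ i $ j) + ereal x) / ereal \<tau>) =
    (if (i, j) \<in> E then exp ((x - real_of_ereal (C $ i $ j)) / \<tau>) else 0)"
proof (cases "C $ i $ j")
  case (real c)
  then have "(i, j) \<in> E" using assms(1) by (auto simp: cost_on_def)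
  then show ?thesis using real assms(2) by (simp add: exp_ereal_def)
next
  case PInf
  then have "(i, j) \<notin> E" using assms(1) by (auto simp: cost_on_def)
  then show ?thesis using PInf assms(2) by (simp add: exp_ereal_def divide_ereal_def)
qed (use assms(1) in \<open>simp add: cost_on_def\<close>)

text \<open>In terms of the real logits \<open>rlogit\<close>, which outside \<open>E\<close> have an arbitrary value that no plan sees, the
  algorithm alternates \<open>row_step\<close> and \<open>col_step\<close>.\<close>

locale sinkhorn_iteration =
  fixes \<mu> :: "real ^ 'm" and \<nu> :: "real ^ 'n" and E :: "('m \<times> 'n) set"
    and C :: "ereal ^ 'n ^ 'm" and \<tau> :: real and f0 :: "real ^ 'm" and g0 :: "real ^ 'n"
  assumes graph: "weighted_graph (\<lambda>i. \<mu> $ i) (\<lambda>j. \<nu> $ j) E"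
    and cost: "cost_on E C" and tau_pos: "0 < \<tau>"
begin

sublocale weighted_graph "\<lambda>i. \<mu> $ i" "\<lambda>j. \<nu> $ j" E by (rule graph)

definition rlogit :: "real ^ 'm \<Rightarrow> real ^ 'n \<Rightarrow> 'm \<Rightarrow> 'n \<Rightarrow> real" where
  "rlogit f g i j = (f $ i + g $ j - real_of_ereal (C $ i $ j)) / \<tau>"

abbreviation "F k \<equiv> sinkhorn_f \<mu> \<nu> C \<tau> f0 g0 k"
abbreviation "G k \<equiv> sinkhorn_g \<mu> \<nu> C \<tau> f0 g0 k"
abbreviation "U k \<equiv> rlogit (F k) (G k)"

lemma f_update_row_incr: "f_update \<nu> C \<tau> g $ i = f $ i + \<tau> * row_incr (rlogit f g) i"
proof -
  define s where "s = (\<Sum>j\<in>UNIV. (if (i, j) \<in> E then exp ((g $ j - real_of_ereal (C $ i $ j)) / \<tau>) else 0) * \<nu> $ j)"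
  have "plan (rlogit f g) i j = \<mu> $ i * exp (f $ i / \<tau>) *
    ((if (i, j) \<in> E then exp ((g $ j - real_of_ereal (C $ i $ j)) / \<tau>) else 0) * \<nu> $ j)" for j
    by (simp add: plan_def rlogit_def add_divide_distrib diff_divide_distrib exp_add exp_diff)
  then have sum: "(\<Sum>j\<in>UNIV. plan (rlogit f g) i j) = \<mu> $ i * exp (f $ i / \<tau>) * s"
    by (simp add: s_def sum_distrib_left)
  then have "0 < s" using row_sum_pos[of "rlogit f g" i] mu_pos[of i] zero_less_mult_pos[of "\<mu> $ i * exp (f $ i / \<tau>)" s] by simp
  then have "row_incr (rlogit f g) i = - (f $ i / \<tau>) - ln s"
    using mu_pos[of i] unfolding row_incr_def sum by (simp add: ln_div ln_mult)
  then have "\<tau> * row_incr (rlogit f g) i = - (f $ i) - \<tau> * ln s"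
    using tau_pos by (simp add: right_diff_distrib)
  moreover have "f_update \<nu> C \<tau> g $ i = - \<tau> * ln s"
    by (simp add: f_update_def exp_ereal_cost[OF cost tau_pos] s_def)
  ultimately show ?thesis by simp
qed

lemma g_update_col_incr: "g_update \<mu> C \<tau> f $ j = g $ j + \<tau> * col_incr (rlogit f g) j"
proof -
  define s where "s = (\<Sum>i\<in>UNIV. (if (i, j) \<in> E then exp ((f $ i - real_of_ereal (C $ i $ j)) / \<tau>) else 0) * \<mu> $ i)"
  have "plan (rlogit f g) i j = \<nu> $ j * exp (g $ j / \<tau>) *
    ((if (i, j) \<in> E then exp ((f $ i - real_of_ereal (C $ i $ j)) / \<tau>) else 0) * \<mu> $ i)" for i
    by (simp add: plan_def rlogit_def add_divide_distrib diff_divide_distrib exp_add exp_diff)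
  then have sum: "(\<Sum>i\<in>UNIV. plan (rlogit f g) i j) = \<nu> $ j * exp (g $ j / \<tau>) * s"
    by (simp add: s_def sum_distrib_left)
  then have "0 < s" using col_sum_pos[of "rlogit f g" j] nu_pos[of j] zero_less_mult_pos[of "\<nu> $ j * exp (g $ j / \<tau>)" s] by simp
  then have "col_incr (rlogit f g) j = - (g $ j / \<tau>) - ln s"
    using nu_pos[of j] unfolding col_incr_def sum by (simp add: ln_div ln_mult)
  then have "\<tau> * col_incr (rlogit f g) j = - (g $ j) - \<tau> * ln s"
    using tau_pos by (simp add: right_diff_distrib)
  moreover have "g_update \<mu> C \<tau> f $ j = - \<tau> * ln s"
    by (simp add: g_update_def exp_ereal_cost[OF cost tau_pos] s_def)
  ultimately show ?thesis by simp
qed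

lemma rlogit_shift:
  "f' $ i + g' $ j = f $ i + g $ j + \<tau> * c \<Longrightarrow> rlogit f' g' i j = rlogit f g i j + c"
  using tau_pos by (simp add: rlogit_def field_simps)

lemma even_step:
  assumes "even k"
  shows "F (Suc k) $ i = F k $ i + \<tau> * row_incr (U k) i" "G (Suc k) = G k"
    "U (Suc k) = row_step (U k)"
proof -
  show f: "F (Suc k) $ i = F k $ i + \<tau> * row_incr (U k) i" for i
    unfolding f_update_row_incr[symmetric]
    using assms by (simp add: sinkhorn_f_def sinkhorn_g_def split_beta)
  show g: "G (Suc k) = G k"
    using assms by (simp add: sinkhorn_g_def split_beta)
  show "U (Suc k) = row_step (U k)"
  proof (intro ext)
    fix i j
    have "U (Suc k) i j = U k i j + row_incr (U k) i" by (rule rlogit_shift) (simp add: f g)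
    then show "U (Suc k) i j = row_step (U k) i j" by (simp only: row_step_def)
  qed
qed

lemma odd_step:
  assumes "odd k"
  shows "G (Suc k) $ j = G k $ j + \<tau> * col_incr (U k) j" "F (Suc k) = F k"
    "U (Suc k) = col_step (U k)"
proof -
  show g: "G (Suc k) $ j = G k $ j + \<tau> * col_incr (U k) j" for j
    unfolding g_update_col_incr[symmetric]
    using assms by (simp add: sinkhorn_f_def sinkhorn_g_def split_beta)
  show f: "F (Suc k) = F k"
    using assms by (simp add: sinkhorn_f_def split_beta)
  show "U (Suc k) = col_step (U k)"
  proof (intro ext)
    fix i j
    have "U (Suc k) i j = U k i j + col_incr (U k) j" by (rule rlogit_shift) (simp add: f g)
    then show "U (Suc k) i j = col_step (U k) i j" by (simp only: col_step_def)
  qed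
qed

text \<open>Odd iterations are the row-normalised states, one sweep apart.\<close>

lemma U_odd: "U (2 * t + 1) = (sweep ^^ t) (row_step (rlogit f0 g0))"
proof (induction t)
  case 0
  then show ?case using even_step(3)[of 0] by (simp add: sinkhorn_f_def sinkhorn_g_def)
next
  case (Suc t)
  have "U (2 * Suc t + 1) = row_step (col_step (U (2 * t + 1)))"
    using odd_step(3)[of "2 * t + 1"] even_step(3)[of "2 * t + 2"] by simp
  also have "\<dots> = sweep (U (2 * t + 1))" by (simp only: sweep_def)
  finally show ?case unfolding Suc.IH by simp
qed

lemma logit_eq: "(i, j) \<in> E \<Longrightarrow> logit \<mu> \<nu> C \<tau> f0 g0 k $ i $ j = ereal (U k i j)"
  using cost tau_pos by (cases "C $ i $ j") (auto simp: logit_def rlogit_def cost_on_def)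

lemma v_incr_odd: "v_incr \<mu> \<nu> C \<tau> f0 g0 (2 * t + 3) $ i = row_incr (col_step (U (2 * t + 1))) i"
proof -
  have "F (2 * t + 3) $ i = F (2 * t + 1) $ i + \<tau> * row_incr (col_step (U (2 * t + 1))) i"
    using even_step(1)[of "2 * t + 2" i] odd_step(2,3)[of "2 * t + 1"] by (simp add: numeral_3_eq_3)
  then show ?thesis using tau_pos by (simp add: v_incr_def)
qed

lemma v_incr_even: "v_incr \<mu> \<nu> C \<tau> f0 g0 (2 * t + 4) $ i = row_incr (col_step (U (2 * t + 1))) i"
proof -
  have k: "2 * t + 4 = Suc (2 * t + 3)" "2 * t + 2 = Suc (2 * t + 1)" by simp_all
  have "F (2 * t + 4) = F (2 * t + 3)" "F (2 * t + 2) = F (2 * t + 1)"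
    unfolding k by (rule odd_step(2), simp)+
  then have "v_incr \<mu> \<nu> C \<tau> f0 g0 (2 * t + 4) = v_incr \<mu> \<nu> C \<tau> f0 g0 (2 * t + 3)"
    by (simp add: v_incr_def)
  then show ?thesis by (simp add: v_incr_odd)
qed

lemma w_incr_even: "w_incr \<mu> \<nu> C \<tau> f0 g0 (2 * t + 2) $ j = col_incr (U (2 * t + 1)) j"
proof -
  have "G (2 * t + 2) $ j = G (2 * t) $ j + \<tau> * col_incr (U (2 * t + 1)) j"
    using odd_step(1)[of "2 * t + 1" j] even_step(2)[of "2 * t"] by simp
  then show ?thesis using tau_pos by (simp add: w_incr_def)
qed

lemma w_incr_odd: "w_incr \<mu> \<nu> C \<tau> f0 g0 (2 * t + 3) $ j = col_incr (U (2 * t + 1)) j"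
proof -
  have k: "2 * t + 3 = Suc (2 * t + 2)" "2 * t + 1 = Suc (2 * t)" by simp_all
  have "G (2 * t + 3) = G (2 * t + 2)" "G (2 * t + 1) = G (2 * t)"
    unfolding k by (rule even_step(2), simp)+
  then have "w_incr \<mu> \<nu> C \<tau> f0 g0 (2 * t + 3) = w_incr \<mu> \<nu> C \<tau> f0 g0 (2 * t + 2)"
    by (simp add: w_incr_def)
  then show ?thesis by (simp only: w_incr_even)
qed

end

theorem proposition2p2:
  fixes \<mu> :: "real ^ 'm" and \<nu> :: "real ^ 'n" and E :: "('m \<times> 'n) set"
  assumes "\<mu> \<in> prob_simplex" and "\<And>i. \<mu> $ i > 0"
    and "\<nu> \<in> prob_simplex" and "\<And>j. \<nu> $ j > 0"
    and "\<And>i. \<exists>j. (i, j) \<in> E" and "\<And>j. \<exists>i. (i, j) \<in> E"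
    and "S_set \<mu> \<nu> E = S_bar \<mu> \<nu> E"
  shows "\<exists>K0 B R :: real. K0 > 0 \<and> B > 0 \<and> R > 0 \<and>
    (\<forall>(C :: ereal ^ 'n ^ 'm) (\<tau> :: real) (\<delta> :: real) (f0 :: real ^ 'm) (g0 :: real ^ 'n).
       cost_on E C \<longrightarrow> \<tau> > 0 \<longrightarrow> \<delta> \<ge> 0 \<longrightarrow>
       (\<forall>i j. (i, j) \<in> E \<longrightarrow> ereal (- \<delta>) \<le> logit \<mu> \<nu> C \<tau> f0 g0 0 $ i $ j \<and>
                              logit \<mu> \<nu> C \<tau> f0 g0 0 $ i $ j \<le> ereal \<delta>) \<longrightarrow>
       (\<forall>i j. (i, j) \<notin> E \<longrightarrow> logit \<mu> \<nu> C \<tau> f0 g0 0 $ i $ j = -\<infinity>) \<longrightarrow>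
       (\<forall>k::nat. real k \<ge> K0 * (1 + \<delta>) \<longrightarrow>
          infnorm (v_incr \<mu> \<nu> C \<tau> f0 g0 k - v_star \<mu> \<nu> E)
            \<le> B * (1 + \<delta>) * (1 - exp (- R * (1 + \<delta>))) ^ k \<and>
          infnorm (w_incr \<mu> \<nu> C \<tau> f0 g0 k - w_star \<mu> \<nu> E)
            \<le> B * (1 + \<delta>) * (1 - exp (- R * (1 + \<delta>))) ^ k))"
proof -
  interpret weighted_graph "\<lambda>i. \<mu> $ i" "\<lambda>j. \<nu> $ j" E
    using assms by unfold_locales (auto simp: prob_simplex_def)
  obtain v w Q where eq: "equilibrium (\<lambda>i. \<mu> $ i) (\<lambda>j. \<nu> $ j) E v w"
    and Q: "equilibrium.equilibrium_plan (\<lambda>i. \<mu> $ i) (\<lambda>j. \<nu> $ j) E v w Q"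
    using equilibrium_exists by blast
  interpret equilibrium "\<lambda>i. \<mu> $ i" "\<lambda>j. \<nu> $ j" E v w by (rule eq)
  note stars = star_eq_equilibrium[OF eq Q]
  have tight: "tight = S_set \<mu> \<nu> E"
    unfolding assms(7) by (simp add: tight_def S_bar_def stars)
  obtain Q' where Q': "equilibrium_plan Q'" "\<And>i j. (i, j) \<in> tight \<Longrightarrow> 0 < Q' i j"
  proof -
    \<comment> \<open>A run with zero cost on \<open>E\<close> provides the convergent logits.\<close>
    define C :: "ereal ^ 'n ^ 'm" where "C = (\<chi> i j. if (i, j) \<in> E then 0 else \<infinity>)"
    have C: "cost_on E C" by (auto simp: cost_on_def C_def split: if_splits)
    interpret sinkhorn_iteration \<mu> \<nu> E C 1 0 0
      by unfold_locales (rule C, simp)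
    have "\<exists>L. (\<lambda>t. (sweep ^^ t) (row_step (rlogit 0 0)) i j) \<longlonglongrightarrow> L" if ij: "(i, j) \<in> tight" for i j
    proof -
      have "\<exists>L::real. (\<lambda>k. logit \<mu> \<nu> C 1 0 0 (2 * k + 1) $ i $ j) \<longlonglongrightarrow> ereal L"
        using ij C unfolding tight S_set_def by auto
      moreover have "(i, j) \<in> E" using ij by (simp add: tight_def)
      ultimately show ?thesis by (simp only: logit_eq U_odd lim_ereal)
    qed
    with that full_plan_of_convergent_logits[OF Q row_normalised_row_step] show thesis by blast
  qed
  from linear_convergence[OF Q'] obtain B R where B: "0 < B" and R: "0 < R" and
    conv: "\<And>\<delta> U t i j. 0 \<le> \<delta> \<Longrightarrow> (\<And>i j. (i, j) \<in> E \<Longrightarrow> \<bar>U i j\<bar> \<le> \<delta>) \<Longrightarrow>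
      \<bar>col_dev ((sweep ^^ t) (row_step U)) j\<bar> \<le> B * (1 + \<delta>) * (1 - exp (- (R * (1 + \<delta>)))) ^ (2 * t + 4) \<and>
      \<bar>row_dev ((sweep ^^ t) (row_step U)) i\<bar> \<le> B * (1 + \<delta>) * (1 - exp (- (R * (1 + \<delta>)))) ^ (2 * t + 4)"
    by blast
  have main: "infnorm (v_incr \<mu> \<nu> C \<tau> f0 g0 k - v_star \<mu> \<nu> E)
        \<le> B * (1 + \<delta>) * (1 - exp (- R * (1 + \<delta>))) ^ k \<and>
      infnorm (w_incr \<mu> \<nu> C \<tau> f0 g0 k - w_star \<mu> \<nu> E)
        \<le> B * (1 + \<delta>) * (1 - exp (- R * (1 + \<delta>))) ^ k"
    if C: "cost_on E C" and \<tau>: "0 < \<tau>" and \<delta>: "0 \<le> \<delta>"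
      and logit0: "\<forall>i j. (i, j) \<in> E \<longrightarrow> ereal (- \<delta>) \<le> logit \<mu> \<nu> C \<tau> f0 g0 0 $ i $ j \<and>
        logit \<mu> \<nu> C \<tau> f0 g0 0 $ i $ j \<le> ereal \<delta>"
      and k: "3 * (1 + \<delta>) \<le> real k" for C \<tau> \<delta> f0 g0 k
  proof -
    interpret sinkhorn_iteration \<mu> \<nu> E C \<tau> f0 g0
      by unfold_locales (rule C, rule \<tau>)
    define q where "q = 1 - exp (- (R * (1 + \<delta>)))"
    have q: "0 \<le> q" "q \<le> 1" using R \<delta> by (auto simp: q_def)
    have U0: "\<bar>rlogit f0 g0 i j\<bar> \<le> \<delta>" if "(i, j) \<in> E" for i j
      using logit0[rule_format, OF that] logit_eq[OF that, of 0]
      by (simp add: sinkhorn_f_def sinkhorn_g_def abs_le_iff)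
    have dev: "\<bar>row_incr (col_step (U (2 * t + 1))) i - v i\<bar> \<le> B * (1 + \<delta>) * q ^ l"
        "\<bar>col_incr (U (2 * t + 1)) j - w j\<bar> \<le> B * (1 + \<delta>) * q ^ l" if "l \<le> 2 * t + 4" for t i j l
    proof -
      have "B * (1 + \<delta>) * q ^ (2 * t + 4) \<le> B * (1 + \<delta>) * q ^ l"
        using that q B \<delta> by (intro mult_left_mono power_decreasing) auto
      moreover have "\<bar>col_dev (U (2 * t + 1)) j\<bar> \<le> B * (1 + \<delta>) * q ^ (2 * t + 4) \<and>
        \<bar>row_dev (U (2 * t + 1)) i\<bar> \<le> B * (1 + \<delta>) * q ^ (2 * t + 4)"
        unfolding U_odd q_def by (rule conv[OF \<delta>]) (rule U0)
      ultimately
      show "\<bar>row_incr (col_step (U (2 * t + 1))) i - v i\<bar> \<le> B * (1 + \<delta>) * q ^ l"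
        "\<bar>col_incr (U (2 * t + 1)) j - w j\<bar> \<le> B * (1 + \<delta>) * q ^ l"
        unfolding row_dev_def col_dev_def by linarith+
    qed
    have "3 + 3 * \<delta> \<le> real k" using k by (simp add: distrib_left)
    then have "3 \<le> k" using \<delta> by linarith
    then obtain s where s: "k = s + 3" using le_Suc_ex[of 3 k] by (auto simp: add.commute)
    have "\<bar>v_incr \<mu> \<nu> C \<tau> f0 g0 k $ i - v i\<bar> \<le> B * (1 + \<delta>) * q ^ k \<and>
      \<bar>w_incr \<mu> \<nu> C \<tau> f0 g0 k $ j - w j\<bar> \<le> B * (1 + \<delta>) * q ^ k" for i j
    \<comment> \<open>Each potential changes at every second iteration only, so both parities read off increments of sweeps.\<close>
    proof (cases "even s")
      case True
      then obtain t where "s = 2 * t" by blast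
      then have k: "k = 2 * t + 3" using s by simp
      show ?thesis unfolding k v_incr_odd w_incr_odd using dev[of "2 * t + 3" t] by simp
    next
      case False
      then obtain t where "s = 2 * t + 1" by (elim oddE)
      then have k: "k = 2 * t + 4" "k = 2 * (t + 1) + 2" using s by simp_all
      have "v_incr \<mu> \<nu> C \<tau> f0 g0 k $ i = row_incr (col_step (U (2 * t + 1))) i"
        unfolding k(1) by (rule v_incr_even)
      moreover have "w_incr \<mu> \<nu> C \<tau> f0 g0 k $ j = col_incr (U (2 * (t + 1) + 1)) j"
        unfolding k(2) by (rule w_incr_even)
      moreover have le: "k \<le> 2 * t + 4" "k \<le> 2 * (t + 1) + 4" using k by simp_all
      ultimately show ?thesis using dev(1)[OF le(1), of i] dev(2)[OF le(2), of j] by (simp only:)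
    qed
    then show ?thesis by (auto simp: stars q_def intro!: infnorm_le_of_components)
  qed
  \<comment> \<open>The row increments before iteration \<open>3\<close> start from the initial state, which need not be normalised.\<close>
  show ?thesis
    by (rule exI[of _ 3], rule exI[of _ B], rule exI[of _ R]) (use main B R in auto)
qed

end
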